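(* The triple $(\mathbf{c},\mathbf{d},\mathbf{B})$ is gaussian-extremizable if and only if $$\sum_{i=1}^k c_i\dim(E_i)=\sum_{j=1}^m d_j\dim(E^j)$$ and there are $V_i\in S^+(E_i)$, $1\le i\le k$, and $\Pi\in\Pi(V_1^{-1},\dots,V_k^{-1})$ such that each $B_j\Lambda_{\mathbf c}\Pi\Lambda_{\mathbf c}B_j^*$ ($1\le j\le m$) is invertible and $$\sum_{j=1}^m d_j\,\Lambda_{\mathbf c}B_j^*\big(B_j\Lambda_{\mathbf c}\Pi\Lambda_{\mathbf c}B_j^*\big)^{-1}B_j\Lambda_{\mathbf c}\le V_{\mathbf c}.$$ Moreover, any such $(V_i)_{1\le i\le k}$ together with $U_j=(B_j\Lambda_{\mathbf c}\Pi\Lambda_{\mathbf c}B_j^* )^{-1}$, $1\le j\le m$, are gaussian extremizers.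
   Context: Let $E_1,\dots,E_k$ and $E^1,\dots,E^m$ be Euclidean spaces (finite-dimensional real Hilbert spaces), $E_0=\bigoplus_{i=1}^kE_i$ (orthogonal direct sum, each $E_i\subseteq E_0$), and $\pi_{E_i}:E_0\to E_i$ the orthogonal projection. Let $\mathbf{B}=(B_{ij})$ with $B_{ij}:E_i\to E^j$ linear, and define $B_j:E_0\to E^j$ by $B_jx=\sum_{i=1}^kB_{ij}\pi_{E_i}(x)$. Let $\mathbf{c}=(c_i)_{1\le i\le k}$, $\mathbf{d}=(d_j)_{1\le j\le m}$ be positive real numbers. $S(E)$ denotes the self-adjoint linear operators on $E$, $S^+(E)$ the positive-definite ones; $A\ge B$ means $A-B$ is positive-semidefinite. Put $\Lambda_{\mathbf c}=\bigoplus_{i=1}^kc_i\,\mathrm{id}_{E_i}$ and, for $V_i\in S^+(E_i)$, $V_{\mathbf c}=\bigoplus_{i=1}^kc_iV_i$ (operators on $E_0$). For $A_i\in S^+(E_i)$, $\Pi(A_1,\dots,A_k)$ is the set of positive-semidefinite $A\in S(E_0)$ with $\langle Ax_i,x_i\rangle=\langle A_ix_i,x_i\rangle$ for all $x_i\in E_i$, $1\le i\le k$. Define $$D_g(\mathbf{c},\mathbf{d},\mathbf{B})=\frac12\sup\Big(\sum_{j=1}^md_j\log\det U_j-\sum_{i=1}^kc_i\log\det V_i\Big),$$ the supremum being over all $V_i\in S^+(E_i)$, $U_j\in S^+(E^j)$ satisfying $$\sum_{j=1}^md_j\Lambda_{\mathbf c}B_j^*U_jB_j\Lambda_{\mathbf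 c}\le V_{\mathbf c}.$$ $(\mathbf{c},\mathbf{d},\mathbf{B})$ is gaussian-extremizable if this supremum is finite and attained by some such $(V_i),(U_j)$; any such attaining operators are called gaussian extremizers. *)

theory Defs
  imports "HOL-Analysis.Analysis" "Jordan_Normal_Form.Determinant"
begin

(* The spaces E_i and E^j are arbitrary linear subspaces of ambient Euclidean spaces 'a and 'b
   (possibly zero, possibly proper).  An operator S -> T between subspaces is represented by a
   function on the ambient type of which only the values on S matter: every notion below
   evaluates an operator on its domain only. *)

subsection \<open>Operators between subspaces\<close>

definition linear_on_subspace ::
    "'a::real_vector set \<Rightarrow> 'b::real_vector set \<Rightarrow> ('a \<Rightarrow> 'b) \<Rightarrow> bool" where
  "linear_on_subspace S T f \<longleftrightarrow>
     (\<forall>x\<in>S. f x \<in> T) \<and>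
     (\<forall>x\<in>S. \<forall>y\<in>S. f (x + y) = f x + f y) \<and>
     (\<forall>r. \<forall>x\<in>S. f (r *\<^sub>R x) = r *\<^sub>R f x)"

definition selfadjoint_ops :: "'a::euclidean_space set \<Rightarrow> ('a \<Rightarrow> 'a) set" where
  "selfadjoint_ops S =
     {f. linear_on_subspace S S f \<and> (\<forall>x\<in>S. \<forall>y\<in>S. inner (f x) y = inner x (f y))}"

definition posdef_ops :: "'a::euclidean_space set \<Rightarrow> ('a \<Rightarrow> 'a) set" where
  "posdef_ops S = {f \<in> selfadjoint_ops S. \<forall>x\<in>S. x \<noteq> 0 \<longrightarrow> 0 < inner (f x) x}"

definition possemidef_ops :: "'a::euclidean_space set \<Rightarrow> ('a \<Rightarrow> 'a) set" where
  "possemidef_ops S = {f \<in> selfadjoint_ops S. \<forall>x\<in>S. 0 \<le> inner (f x) x}"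

definition loewner_le :: "'a::euclidean_space set \<Rightarrow> ('a \<Rightarrow> 'a) \<Rightarrow> ('a \<Rightarrow> 'a) \<Rightarrow> bool" where
  "loewner_le S f g \<longleftrightarrow> (\<lambda>x. g x - f x) \<in> possemidef_ops S"

definition orth_proj :: "'a::euclidean_space set \<Rightarrow> 'a \<Rightarrow> 'a" where
  "orth_proj S x = (THE y. y \<in> S \<and> (\<forall>z\<in>S. inner (x - y) z = 0))"

(* The adjoint of an operator f with domain S. *)
definition adjoint_on ::
    "'a::euclidean_space set \<Rightarrow> ('a \<Rightarrow> 'b::euclidean_space) \<Rightarrow> 'b \<Rightarrow> 'a" where
  "adjoint_on S f y = (THE x. x \<in> S \<and> (\<forall>z\<in>S. inner (f z) y = inner z x))"

definition orthonormal_basis :: "'a::euclidean_space set \<Rightarrow> 'a list \<Rightarrow> bool" where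
  "orthonormal_basis S bs \<longleftrightarrow>
     distinct bs \<and> span (set bs) = S \<and>
     (\<forall>u\<in>set bs. \<forall>v\<in>set bs. inner u v = (if u = v then 1 else 0))"

(* The determinant of f : S -> S, read off from its matrix in some orthonormal basis of S; the
   value does not depend on the basis chosen, and it is 1 for S = {0}. *)
definition det_on :: "'a::euclidean_space set \<Rightarrow> ('a \<Rightarrow> 'a) \<Rightarrow> real" where
  "det_on S f =
     (let bs = (SOME bs. orthonormal_basis S bs); n = length bs
      in Determinant.det (Matrix.mat n n (\<lambda>(r, s). inner (bs ! r) (f (bs ! s)))))"

subsection \<open>The orthogonal direct sum\<close>

definition total_space :: "('k::finite \<Rightarrow> 'a::euclidean_space set) \<Rightarrow> 'a set" where
  "total_space E = span (\<Union>i. E i)"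

definition orthogonal_subspaces :: "('k::finite \<Rightarrow> 'a::euclidean_space set) \<Rightarrow> bool" where
  "orthogonal_subspaces E \<longleftrightarrow>
     (\<forall>i. subspace (E i)) \<and>
     (\<forall>i i'. i \<noteq> i' \<longrightarrow> (\<forall>x\<in>E i. \<forall>y\<in>E i'. inner x y = 0))"

definition sum_op ::
    "('k::finite \<Rightarrow> 'a::euclidean_space set) \<Rightarrow> ('k \<Rightarrow> 'a \<Rightarrow> 'b::real_vector) \<Rightarrow> 'a \<Rightarrow> 'b" where
  "sum_op E T x = (\<Sum>i\<in>UNIV. T i (orth_proj (E i) x))"

definition B_total ::
    "('k::finite \<Rightarrow> 'a::euclidean_space set) \<Rightarrow> ('k \<Rightarrow> 'm \<Rightarrow> 'a \<Rightarrow> 'b::euclidean_space)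
      \<Rightarrow> 'm \<Rightarrow> 'a \<Rightarrow> 'b" where
  "B_total E B j = sum_op E (\<lambda>i. B i j)"

definition B_adj ::
    "('k::finite \<Rightarrow> 'a::euclidean_space set) \<Rightarrow> ('k \<Rightarrow> 'm \<Rightarrow> 'a \<Rightarrow> 'b::euclidean_space)
      \<Rightarrow> 'm \<Rightarrow> 'b \<Rightarrow> 'a" where
  "B_adj E B j = adjoint_on (total_space E) (B_total E B j)"

definition Lam :: "('k::finite \<Rightarrow> 'a::euclidean_space set) \<Rightarrow> ('k \<Rightarrow> real) \<Rightarrow> 'a \<Rightarrow> 'a" where
  "Lam E c = sum_op E (\<lambda>i x. c i *\<^sub>R x)"

definition weighted_sum_op ::
    "('k::finite \<Rightarrow> 'a::euclidean_space set) \<Rightarrow> ('k \<Rightarrow> real) \<Rightarrow> ('k \<Rightarrow> 'a \<Rightarrow> 'a) \<Rightarrow> 'a \<Rightarrow> 'a" where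
  "weighted_sum_op E c V = sum_op E (\<lambda>i x. c i *\<^sub>R V i x)"

definition couplings ::
    "('k::finite \<Rightarrow> 'a::euclidean_space set) \<Rightarrow> ('k \<Rightarrow> 'a \<Rightarrow> 'a) \<Rightarrow> ('a \<Rightarrow> 'a) set" where
  "couplings E A =
     {P \<in> possemidef_ops (total_space E). \<forall>i. \<forall>x\<in>E i. inner (P x) x = inner (A i x) x}"

subsection \<open>The gaussian constant\<close>

definition U_form ::
    "('k::finite \<Rightarrow> 'a::euclidean_space set) \<Rightarrow> ('k \<Rightarrow> real) \<Rightarrow> ('m::finite \<Rightarrow> real)
      \<Rightarrow> ('k \<Rightarrow> 'm \<Rightarrow> 'a \<Rightarrow> 'b::euclidean_space) \<Rightarrow> ('m \<Rightarrow> 'b \<Rightarrow> 'b) \<Rightarrow> 'a \<Rightarrow> 'a" where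
  "U_form E c d B U x =
     (\<Sum>j\<in>UNIV. d j *\<^sub>R Lam E c (B_adj E B j (U j (B_total E B j (Lam E c x)))))"

definition gaussian_feasible ::
    "('k::finite \<Rightarrow> 'a::euclidean_space set) \<Rightarrow> ('m::finite \<Rightarrow> 'b::euclidean_space set)
      \<Rightarrow> ('k \<Rightarrow> real) \<Rightarrow> ('m \<Rightarrow> real) \<Rightarrow> ('k \<Rightarrow> 'm \<Rightarrow> 'a \<Rightarrow> 'b)
      \<Rightarrow> (('k \<Rightarrow> 'a \<Rightarrow> 'a) \<times> ('m \<Rightarrow> 'b \<Rightarrow> 'b)) set" where
  "gaussian_feasible E F c d B =
     {(V, U). (\<forall>i. V i \<in> posdef_ops (E i)) \<and> (\<forall>j. U j \<in> posdef_ops (F j)) \<and>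
        loewner_le (total_space E) (U_form E c d B U) (weighted_sum_op E c V)}"

definition gaussian_value ::
    "('k::finite \<Rightarrow> 'a::euclidean_space set) \<Rightarrow> ('m::finite \<Rightarrow> 'b::euclidean_space set)
      \<Rightarrow> ('k \<Rightarrow> real) \<Rightarrow> ('m \<Rightarrow> real) \<Rightarrow> ('k \<Rightarrow> 'a \<Rightarrow> 'a) \<Rightarrow> ('m \<Rightarrow> 'b \<Rightarrow> 'b) \<Rightarrow> real" where
  "gaussian_value E F c d V U =
     (\<Sum>j\<in>UNIV. d j * ln (det_on (F j) (U j))) - (\<Sum>i\<in>UNIV. c i * ln (det_on (E i) (V i)))"

definition D_g ::
    "('k::finite \<Rightarrow> 'a::euclidean_space set) \<Rightarrow> ('m::finite \<Rightarrow> 'b::euclidean_space set)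
      \<Rightarrow> ('k \<Rightarrow> real) \<Rightarrow> ('m \<Rightarrow> real) \<Rightarrow> ('k \<Rightarrow> 'm \<Rightarrow> 'a \<Rightarrow> 'b) \<Rightarrow> ereal" where
  "D_g E F c d B =
     ereal (1/2) * (SUP (V, U) \<in> gaussian_feasible E F c d B. ereal (gaussian_value E F c d V U))"

definition gaussian_extremizer ::
    "('k::finite \<Rightarrow> 'a::euclidean_space set) \<Rightarrow> ('m::finite \<Rightarrow> 'b::euclidean_space set)
      \<Rightarrow> ('k \<Rightarrow> real) \<Rightarrow> ('m \<Rightarrow> real) \<Rightarrow> ('k \<Rightarrow> 'm \<Rightarrow> 'a \<Rightarrow> 'b)
      \<Rightarrow> ('k \<Rightarrow> 'a \<Rightarrow> 'a) \<Rightarrow> ('m \<Rightarrow> 'b \<Rightarrow> 'b) \<Rightarrow> bool" where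
  "gaussian_extremizer E F c d B V U \<longleftrightarrow>
     (V, U) \<in> gaussian_feasible E F c d B \<and>
     D_g E F c d B = ereal (1/2 * gaussian_value E F c d V U)"

definition gaussian_extremizable ::
    "('k::finite \<Rightarrow> 'a::euclidean_space set) \<Rightarrow> ('m::finite \<Rightarrow> 'b::euclidean_space set)
      \<Rightarrow> ('k \<Rightarrow> real) \<Rightarrow> ('m \<Rightarrow> real) \<Rightarrow> ('k \<Rightarrow> 'm \<Rightarrow> 'a \<Rightarrow> 'b) \<Rightarrow> bool" where
  "gaussian_extremizable E F c d B \<longleftrightarrow>
     \<bar>D_g E F c d B\<bar> \<noteq> \<infinity> \<and> (\<exists>V U. gaussian_extremizer E F c d B V U)"

definition B_cov ::
    "('k::finite \<Rightarrow> 'a::euclidean_space set) \<Rightarrow> ('k \<Rightarrow> real)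
      \<Rightarrow> ('k \<Rightarrow> 'm \<Rightarrow> 'a \<Rightarrow> 'b::euclidean_space) \<Rightarrow> ('a \<Rightarrow> 'a) \<Rightarrow> 'm \<Rightarrow> 'b \<Rightarrow> 'b" where
  "B_cov E c B P j y = B_total E B j (Lam E c (P (Lam E c (B_adj E B j y))))"

end

theory Submission
  imports Defs
begin

text \<open>
  Sufficiency. The feasible set is closed under taking geometric means of two pairs $(V,U)$, and
  the objective is affine along the corresponding geodesics. Hence a feasible pair $(V',U')$ can be
  contracted along the geodesic towards the stationary pair $(V,U)$ by a factor $t = 2^{-n}$.
  Pairing the operator inequality at parameter $t$ with the coupling $\Pi$ bounds $t$ times the
  gain in the objective by $\sum_i c_i \sum_l (\mu_{il}^t - 1 - t \log \mu_{il})$, where the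
  dimension identity cancels the constants. This is $o(t)$, so there is no gain.

  Necessity. Scaling $(V,U)$ by a positive number gives the dimension identity. First-order
  variations $V_i + t H_i$, $U_j + t K_j$ that preserve the constraint cannot increase the
  objective; Farkas' lemma for the cone of positive semidefinite operators turns this into the
  existence of the multiplier $\Pi$.

  In both parts, determinants and traces are computed in a basis that diagonalizes two quadratic
  forms simultaneously.
\<close>

subsection \<open>Simultaneous diagonalization\<close>

text \<open>The obstacle is that the objective is not concave: log det of U_j is concave, but minus
  log det of V_i is convex, so stationarity along straight segments gives no global conclusion. This
  is why the competitor is joined to (V, U) by the curve on which its eigenvalues relative to (V, U)
  are raised to the power t. A single square root is the only operator inequality required for this,
  which is the reason for dyadic t. Pairing with the coupling yields plain numbers for the following
  reason: its diagonal blocks are the inverses of the V_i, and its images under B_j Lambda_c are the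
  inverses of the U_j. In bases diagonalizing V_i with V'_i, and U_j with U'_j, each diagonal entry
  of these inverses is exactly 1, so only sums of powers of relative eigenvalues remain. The
  multiplier obtained pushes forward to the inverse of U_j, so the inequality demanded by the
  theorem is the feasibility of the extremizer.\<close>

lemma quadratic_nonneg_imp_linear_zero:
  fixes p r :: real
  assumes "\<And>s. 0 \<le> 2 * s * p + s\<^sup>2 * r"
  shows "p = 0"
proof (rule ccontr)
  assume "p \<noteq> 0"
  have r: "0 \<le> r" using assms[of 1] assms[of "-1"] by simp
  \<comment> \<open>The vertex of the parabola is at -p/r. Using r + 1 keeps the denominator
    positive when r = 0 and still makes the value negative, namely -s^2 (r + 2).\<close>
  define s where "s = - p / (r + 1)"
  have p: "p = - s * (r + 1)" using r by (simp add: s_def)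
  have "s \<noteq> 0" using \<open>p \<noteq> 0\<close> r by (simp add: s_def)
  have "2 * s * p + s\<^sup>2 * r = - (s\<^sup>2 * (r + 2))"
    by (simp add: p power2_eq_square algebra_simps)
  moreover have "s\<^sup>2 * (r + 2) > 0" using \<open>s \<noteq> 0\<close> r by simp
  ultimately show False using assms[of s] by linarith
qed

text \<open>On the line x + s y the form has no constant term, so nonnegativity for all s, of either
  sign, kills the linear term.\<close>

lemma psd_form_kernel:
  fixes q :: "'a::real_vector \<Rightarrow> 'a \<Rightarrow> real"
  assumes q: "bilinear q" and sym: "\<And>x y. q x y = q y x" and T: "subspace T"
    and psd: "\<And>x. x \<in> T \<Longrightarrow> 0 \<le> q x x" and x: "x \<in> T" "q x x = 0" and y: "y \<in> T"
  shows "q x y = 0"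
proof (rule quadratic_nonneg_imp_linear_zero)
  fix s :: real
  have "0 \<le> q (x + s *\<^sub>R y) (x + s *\<^sub>R y)"
    using T x(1) y by (intro psd subspace_add subspace_scale)
  also have "\<dots> = 2 * s * q x y + s\<^sup>2 * q y y"
    using sym[of y x] x(2) bilinear_ladd[OF q] bilinear_radd[OF q] bilinear_lmul[OF q] bilinear_rmul[OF q]
    by (simp add: power2_eq_square algebra_simps)
  finally show "0 \<le> 2 * s * q x y + s\<^sup>2 * q y y" .
qed

text \<open>Induction on the dimension by the variational method: a maximizer of the quotient b/a
  splits off, and its a-orthogonal complement is also b-orthogonal to it. The last clause says that
  \<open>e\<close> is a basis with coordinates read off by a.\<close>

lemma simultaneous_diagonalization_forms:
  fixes a b :: "'a::euclidean_space \<Rightarrow> 'a \<Rightarrow> real"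
  assumes a: "bilinear a" and b: "bilinear b"
    and asym: "\<And>x y. a x y = a y x" and bsym: "\<And>x y. b x y = b y x"
    and "subspace T" and "\<And>x. x \<in> T \<Longrightarrow> x \<noteq> 0 \<Longrightarrow> 0 < a x x"
  shows "\<exists>e \<mu>. (\<forall>l<dim T. e l \<in> T) \<and>
    (\<forall>l<dim T. \<forall>m<dim T. a (e l) (e m) = (if l = m then 1 else 0)) \<and>
    (\<forall>l<dim T. \<forall>m<dim T. b (e l) (e m) = (if l = m then \<mu> l else 0)) \<and>
    (\<forall>x\<in>T. x = (\<Sum>l<dim T. a x (e l) *\<^sub>R e l))"
  using assms(5,6)
proof (induction "dim T" arbitrary: T)
  case 0
  then have "T \<subseteq> {0}" using dim_eq_0 by metis
  then show ?case unfolding 0(1)[symmetric] by auto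
next
  case (Suc n)
  note T = Suc.prems(1) and apos = Suc.prems(2)
  obtain w where w: "w \<in> T" "w \<noteq> 0"
    using Suc(2) by (metis dim_eq_0 nat.distinct(1) singletonI subset_eq)
  \<comment> \<open>The quotient is invariant under scaling, so the Euclidean unit sphere of T can
    serve as the compact set on which it is maximized.\<close>
  define K where "K = T \<inter> sphere 0 1"
  have "compact K" unfolding K_def
    using closed_subspace[OF T] by (intro closed_Int_compact) auto
  moreover have "w /\<^sub>R norm w \<in> K" using w T by (auto simp: K_def subspace_scale)
  moreover have "continuous_on K (\<lambda>x. b x x / a x x)"
  proof (intro continuous_on_divide bilinear_continuous_on_compose[OF _ _ a] bilinear_continuous_on_compose[OF _ _ b]
      continuous_on_id ballI)
    fix x assume "x \<in> K"
    then show "a x x \<noteq> 0" using apos[of x] by (force simp: K_def)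
  qed
  ultimately obtain x0 where x0: "x0 \<in> K" and max: "\<And>y. y \<in> K \<Longrightarrow> b y y / a y y \<le> b x0 x0 / a x0 x0"
    using continuous_attains_sup[of K "\<lambda>x. b x x / a x x"] by blast
  define \<mu>0 where "\<mu>0 = b x0 x0 / a x0 x0"
  have x0T: "x0 \<in> T" "x0 \<noteq> 0" using x0 by (auto simp: K_def)
  have a0: "a x0 x0 > 0" using apos x0T by blast
  \<comment> \<open>Maximality of \<open>\<mu>0\<close> says that q is positive semidefinite on T,
    and q vanishes at the maximizer. Hence the maximizer lies in the kernel of q, which is the
    eigenvector equation b(x0, y) = \<open>\<mu>0\<close> a(x0, y) for y in T.\<close>
  define q where "q x y = \<mu>0 * a x y - b x y" for x y
  have q: "bilinear q"
    unfolding q_def bilinear_def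
    using bilinear_ladd[OF a] bilinear_radd[OF a] bilinear_lmul[OF a] bilinear_rmul[OF a]
      bilinear_ladd[OF b] bilinear_radd[OF b] bilinear_lmul[OF b] bilinear_rmul[OF b]
    by (auto intro!: linearI simp: algebra_simps)
  have qsym: "q x y = q y x" for x y using asym bsym by (simp add: q_def)
  have qpsd: "0 \<le> q y y" if "y \<in> T" for y
  proof (cases "y = 0")
    case True then show ?thesis using bilinear_lzero[OF q] by simp
  next
    case False
    have "a y y > 0" using apos that False by blast
    have "y /\<^sub>R norm y \<in> K" using False T that by (auto simp: K_def subspace_scale)
    from max[OF this] have "b y y / a y y \<le> \<mu>0"
      using False by (simp add: \<mu>0_def bilinear_lmul[OF a] bilinear_rmul[OF a] bilinear_lmul[OF b] bilinear_rmul[OF b])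
    then show ?thesis using \<open>a y y > 0\<close> by (simp add: q_def divide_le_eq)
  qed
  define x1 where "x1 = x0 /\<^sub>R sqrt (a x0 x0)"
  have x1T: "x1 \<in> T" using x0T T by (simp add: x1_def subspace_scale)
  have a1: "a x1 x1 = 1"
    using a0 by (simp add: x1_def bilinear_lmul[OF a] bilinear_rmul[OF a] field_simps)
  have "q x1 x1 = 0"
    using a0 by (simp add: q_def x1_def \<mu>0_def bilinear_lmul[OF a] bilinear_rmul[OF a] bilinear_lmul[OF b] bilinear_rmul[OF b])
  then have q1: "q x1 y = 0" if "y \<in> T" for y
    using psd_form_kernel[OF q qsym T qpsd x1T] that by blast
  define T' where "T' = {y \<in> T. a x1 y = 0}"
  have T': "subspace T'"
    using T by (auto simp: T'_def subspace_def bilinear_radd[OF a] bilinear_rmul[OF a] bilinear_rzero[OF a])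
  have proj: "y - a x1 y *\<^sub>R x1 \<in> T'" if "y \<in> T" for y
    using that T x1T a1 by (auto simp: T'_def bilinear_rsub[OF a] bilinear_rmul[OF a] subspace_diff subspace_scale)
  have x1: "x1 \<notin> span T'" using a1 T' by (simp add: T'_def span_eq_iff[THEN iffD2])
  have "span (insert x1 T') = T"
  proof
    show "span (insert x1 T') \<subseteq> T" using T x1T by (intro span_minimal) (auto simp: T'_def)
    show "T \<subseteq> span (insert x1 T')"
    proof
      fix y assume "y \<in> T"
      then have "y - a x1 y *\<^sub>R x1 \<in> span T'" using proj span_base by blast
      then show "y \<in> span (insert x1 T')" using span_breakdown_eq by blast
    qed
  qed
  then have "dim T = dim T' + 1" using x1 dim_insert[of x1 T'] by (metis dim_span)
  then have n: "n = dim T'" using Suc(2) by simp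
  obtain e \<mu> where eT: "\<forall>l<n. e l \<in> T'"
    and ea: "\<forall>l<n. \<forall>m<n. a (e l) (e m) = (if l = m then 1 else 0)"
    and eb: "\<forall>l<n. \<forall>m<n. b (e l) (e m) = (if l = m then \<mu> l else 0)"
    and ex: "\<forall>x\<in>T'. x = (\<Sum>l<n. a x (e l) *\<^sub>R e l)"
    using Suc(1)[OF n T'] apos unfolding n[symmetric] by (auto simp: T'_def)
  have b1: "b x1 y = \<mu>0 * a x1 y" if "y \<in> T" for y using q1[OF that] by (simp add: q_def)
  have ea1: "a x1 (e l) = 0" "a (e l) x1 = 0" "b x1 (e l) = 0" "b (e l) x1 = 0" "e l \<in> T" if "l < n" for l
    using eT that b1[of "e l"] asym[of x1] bsym[of x1] by (auto simp: T'_def)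
  have "\<forall>x\<in>T. x = (\<Sum>l<Suc n. a x ((e(n := x1)) l) *\<^sub>R (e(n := x1)) l)"
  proof
    fix x assume "x \<in> T"
    define y where "y = x - a x1 x *\<^sub>R x1"
    have "y = (\<Sum>l<n. a y (e l) *\<^sub>R e l)" using proj[OF \<open>x \<in> T\<close>] ex unfolding y_def by blast
    also have "\<dots> = (\<Sum>l<n. a x (e l) *\<^sub>R e l)"
      using ea1 by (intro sum.cong) (auto simp: y_def bilinear_lsub[OF a] bilinear_lmul[OF a])
    finally show "x = (\<Sum>l<Suc n. a x ((e(n := x1)) l) *\<^sub>R (e(n := x1)) l)"
      using asym by (simp add: y_def algebra_simps)
  qed
  then have "(\<forall>l<Suc n. (e(n := x1)) l \<in> T) \<and>
    (\<forall>l<Suc n. \<forall>m<Suc n. a ((e(n := x1)) l) ((e(n := x1)) m) = (if l = m then 1 else 0)) \<and>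
    (\<forall>l<Suc n. \<forall>m<Suc n. b ((e(n := x1)) l) ((e(n := x1)) m) = (if l = m then (\<mu>(n := \<mu>0)) l else 0)) \<and>
    (\<forall>x\<in>T. x = (\<Sum>l<Suc n. a x ((e(n := x1)) l) *\<^sub>R (e(n := x1)) l))"
    using ea eb ea1 a1 x1T b1[OF x1T] by (auto simp: less_Suc_eq)
  then show ?case unfolding Suc(2)[symmetric] by blast
qed

section \<open>Orthogonal projections and operators known only on a subspace\<close>

lemma orth_proj_ex:
  fixes S :: "'a::euclidean_space set"
  assumes S: "subspace S"
  shows "\<exists>!y. y \<in> S \<and> (\<forall>z\<in>S. inner (x - y) z = 0)"
proof -
  obtain y z where yz: "y \<in> span S" "\<And>w. w \<in> span S \<Longrightarrow> real_inner_class.orthogonal z w" "x = y + z"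
    using orthogonal_subspace_decomp_exists[of S x] by blast
  show ?thesis
  proof (rule ex1I[of _ y])
    show "y \<in> S \<and> (\<forall>z\<in>S. inner (x - y) z = 0)"
      using yz S by (auto simp: span_eq_iff[THEN iffD2] real_inner_class.orthogonal_def)
    fix y' assume y': "y' \<in> S \<and> (\<forall>z\<in>S. inner (x - y') z = 0)"
    have "y \<in> S" using yz S by (simp add: span_eq_iff[THEN iffD2])
    then have d: "y' - y \<in> S" using y' S by (simp add: subspace_diff)
    then have "inner (x - y) (y' - y) = 0" "inner (x - y') (y' - y) = 0"
      using y' yz S by (auto simp: span_eq_iff[THEN iffD2] real_inner_class.orthogonal_def)
    then have "inner (y' - y) (y' - y) = 0" by (simp add: inner_diff_left)
    then show "y' = y" by simp
  qed
qed

lemma orth_proj_in: "subspace S \<Longrightarrow> orth_proj S x \<in> S"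
  and orth_proj_orth: "subspace S \<Longrightarrow> z \<in> S \<Longrightarrow> inner (x - orth_proj S x) z = 0"
  using theI'[OF orth_proj_ex[of S x]] unfolding orth_proj_def by auto

lemma orth_proj_eqI:
  assumes "subspace S" "y \<in> S" "\<And>z. z \<in> S \<Longrightarrow> inner (x - y) z = 0"
  shows "orth_proj S x = y"
  unfolding orth_proj_def using assms by (intro the1_equality orth_proj_ex) auto

lemma orth_proj_id: "subspace S \<Longrightarrow> x \<in> S \<Longrightarrow> orth_proj S x = x"
  by (rule orth_proj_eqI) auto

lemma inner_orth_proj: "subspace S \<Longrightarrow> z \<in> S \<Longrightarrow> inner (orth_proj S x) z = inner x z"
  using orth_proj_orth[of S z x] by (simp add: inner_diff_left)

lemma orth_proj_selfadjoint: "subspace S \<Longrightarrow> inner (orth_proj S x) y = inner x (orth_proj S y)"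
  by (metis inner_orth_proj orth_proj_in inner_commute)

lemma orth_proj_zero: "subspace S \<Longrightarrow> (\<And>z. z \<in> S \<Longrightarrow> inner x z = 0) \<Longrightarrow> orth_proj S x = 0"
  by (rule orth_proj_eqI) (auto simp: subspace_0)

lemma linear_orth_proj:
  assumes "subspace S" shows "linear (orth_proj S)"
proof (rule linearI)
  show "orth_proj S (x + y) = orth_proj S x + orth_proj S y" for x y
    by (rule orth_proj_eqI)
      (use assms in \<open>auto simp: subspace_add orth_proj_in inner_add_left inner_diff_left inner_orth_proj\<close>)
  show "orth_proj S (r *\<^sub>R x) = r *\<^sub>R orth_proj S x" for r x
    by (rule orth_proj_eqI)
      (use assms in \<open>auto simp: subspace_scale orth_proj_in inner_diff_left inner_orth_proj\<close>)
qed

text \<open>An operator is constrained on its domain only. Composing it with the projection gives a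
  map linear on the whole type, to which the general facts about \<open>linear\<close>
  apply.\<close>

lemma linear_on_subspace_ext:
  fixes S :: "'a::euclidean_space set"
  assumes "subspace S" "linear_on_subspace S T f"
  shows "linear (\<lambda>x. f (orth_proj S x))"
  using assms linear_orth_proj[OF assms(1)] orth_proj_in[OF assms(1)]
  by (auto intro!: linearI simp: linear_on_subspace_def linear_add linear_scale)

lemma linear_on_subspace_sum:
  fixes S :: "'a::euclidean_space set"
  assumes S: "subspace S" and f: "linear_on_subspace S T f" and e: "\<And>l. l \<in> I \<Longrightarrow> e l \<in> S"
  shows "f (\<Sum>l\<in>I. r l *\<^sub>R e l) = (\<Sum>l\<in>I. r l *\<^sub>R f (e l))"
proof -
  interpret f: linear "\<lambda>x. f (orth_proj S x)" by (rule linear_on_subspace_ext[OF S f])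
  have "(\<Sum>l\<in>I. r l *\<^sub>R e l) \<in> S" using e S by (intro subspace_sum subspace_scale)
  then have "f (\<Sum>l\<in>I. r l *\<^sub>R e l) = f (orth_proj S (\<Sum>l\<in>I. r l *\<^sub>R e l))" by (simp add: orth_proj_id[OF S])
  also have "\<dots> = (\<Sum>l\<in>I. r l *\<^sub>R f (e l))" using e
    by (simp add: f.sum f.scale orth_proj_id[OF S])
  finally show ?thesis .
qed

lemma subspace_eqI:
  assumes "subspace S" "u \<in> S" "v \<in> S" "\<And>y. y \<in> S \<Longrightarrow> inner u y = inner v y"
  shows "u = v"
proof -
  have "inner (u - v) (u - v) = 0"
    using assms subspace_diff[OF assms(1-3)] by (simp add: inner_diff_left)
  then show ?thesis by simp
qed

section \<open>Dual frames and the operators that are diagonal in them\<close>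

text \<open>A basis and its dual basis. A basis that diagonalizes two forms is in general not
  orthonormal, hence the two families; \<open>dual_frame S e e\<close> means that e is an
  orthonormal basis.\<close>

definition dual_frame :: "'a::euclidean_space set \<Rightarrow> (nat \<Rightarrow> 'a) \<Rightarrow> (nat \<Rightarrow> 'a) \<Rightarrow> bool" where
  "dual_frame S e f \<longleftrightarrow>
     (\<forall>l<dim S. e l \<in> S \<and> f l \<in> S) \<and>
     (\<forall>l<dim S. \<forall>m<dim S. inner (e l) (f m) = (if l = m then 1 else 0)) \<and>
     (\<forall>x\<in>S. x = (\<Sum>l<dim S. inner x (f l) *\<^sub>R e l))"

text \<open>The symmetric operator whose quadratic form is diagonal in the coordinates given by f.
  The weights \<open>\<mu>\<close> are its eigenvalues relative to the operator with all weights
  1.\<close>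

definition frame_op ::
    "'a::euclidean_space set \<Rightarrow> (nat \<Rightarrow> 'a) \<Rightarrow> (nat \<Rightarrow> real) \<Rightarrow> 'a \<Rightarrow> 'a" where
  "frame_op S f \<mu> x = (\<Sum>l<dim S. (\<mu> l * inner x (f l)) *\<^sub>R f l)"

lemma dual_frame_sym:
  assumes S: "subspace S" and ef: "dual_frame S e f"
  shows "dual_frame S f e"
proof -
  have "x = (\<Sum>l<dim S. inner x (e l) *\<^sub>R f l)" if "x \<in> S" for x
  proof (rule subspace_eqI[OF S that])
    show "(\<Sum>l<dim S. inner x (e l) *\<^sub>R f l) \<in> S"
      using ef S by (intro subspace_sum subspace_scale) (auto simp: dual_frame_def)
    fix y assume "y \<in> S"
    then have "inner x y = inner x (\<Sum>l<dim S. inner y (f l) *\<^sub>R e l)"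
      using ef unfolding dual_frame_def by simp
    also have "\<dots> = inner (\<Sum>l<dim S. inner x (e l) *\<^sub>R f l) y"
      by (simp add: inner_sum_left inner_sum_right inner_commute mult.commute)
    finally show "inner x y = inner (\<Sum>l<dim S. inner x (e l) *\<^sub>R f l) y" .
  qed
  then show ?thesis using ef unfolding dual_frame_def by (auto simp: inner_commute)
qed

lemma inner_frame_op: "inner (frame_op S f \<mu> x) y = (\<Sum>l<dim S. \<mu> l * inner x (f l) * inner y (f l))"
  by (simp add: frame_op_def inner_sum_left inner_commute[of y])

lemma linear_frame_op: "linear (frame_op S f \<mu>)"
  unfolding frame_op_def
  by (intro linear_compose_sum ballI linearI) (auto simp: inner_add_left algebra_simps)

lemma frame_op_in: "subspace S \<Longrightarrow> dual_frame S e f \<Longrightarrow> frame_op S f \<mu> x \<in> S"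
  unfolding frame_op_def dual_frame_def by (intro subspace_sum subspace_scale) auto

lemma selfadjoint_frame_op:
  assumes "subspace S" "dual_frame S e f"
  shows "frame_op S f \<mu> \<in> selfadjoint_ops S"
proof -
  have "inner (frame_op S f \<mu> x) y = inner x (frame_op S f \<mu> y)" for x y
    by (subst (2) inner_commute) (simp add: inner_frame_op mult.assoc mult.commute[of "inner x _"])
  then show ?thesis
    using assms linear_frame_op[of S f \<mu>]
    by (auto simp: selfadjoint_ops_def linear_on_subspace_def frame_op_in linear_add linear_scale)
qed

lemma posdef_frame_op:
  assumes S: "subspace S" and ef: "dual_frame S e f" and \<mu>: "\<And>l. l < dim S \<Longrightarrow> 0 < \<mu> l"
  shows "frame_op S f \<mu> \<in> posdef_ops S"
proof -
  have "0 < inner (frame_op S f \<mu> x) x" if "x \<in> S" "x \<noteq> 0" for x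
  proof -
    have "\<exists>l<dim S. inner x (f l) \<noteq> 0"
    proof (rule ccontr)
      assume "\<not> ?thesis"
      then have "(\<Sum>l<dim S. inner x (f l) *\<^sub>R e l) = 0" by (intro sum.neutral) auto
      then show False using ef that unfolding dual_frame_def by metis
    qed
    then obtain l where "l < dim S" "inner x (f l) \<noteq> 0" by blast
    then have "0 < (\<Sum>l<dim S. \<mu> l * (inner x (f l))\<^sup>2)"
      using \<mu> by (intro sum_pos2[of _ l]) (auto simp: less_imp_le)
    then show ?thesis by (simp add: inner_frame_op power2_eq_square mult.assoc)
  qed
  then show ?thesis using selfadjoint_frame_op[OF S ef] by (auto simp: posdef_ops_def)
qed

lemma frame_op_dual:
  assumes "subspace S" "dual_frame S e f" "l < dim S"
  shows "frame_op S f \<mu> (e l) = \<mu> l *\<^sub>R f l"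
proof -
  have "frame_op S f \<mu> (e l) = (\<Sum>m<dim S. if m = l then \<mu> l *\<^sub>R f l else 0)"
    unfolding frame_op_def using assms(2,3) by (intro sum.cong) (auto simp: dual_frame_def)
  then show ?thesis using assms(3) by simp
qed

text \<open>With unit weights, the operator built from f sends each \<open>e l\<close> to
  \<open>f l\<close>, and the one built from e sends it back. Exchanging the two families therefore
  inverts.\<close>

lemma frame_op_inverse:
  assumes S: "subspace S" and ef: "dual_frame S e f" and x: "x \<in> S"
  shows "frame_op S f (\<lambda>_. 1) (frame_op S e (\<lambda>_. 1) x) = x"
proof -
  interpret linear "frame_op S f (\<lambda>_. 1)" by (rule linear_frame_op)
  have "frame_op S f (\<lambda>_. 1) (frame_op S e (\<lambda>_. 1) x) =
      (\<Sum>l<dim S. inner x (e l) *\<^sub>R frame_op S f (\<lambda>_. 1) (e l))"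
    by (simp add: frame_op_def[of S e] sum scale)
  also have "\<dots> = (\<Sum>l<dim S. inner x (e l) *\<^sub>R f l)"
    using frame_op_dual[OF S ef] by (intro sum.cong) auto
  also have "\<dots> = x" using dual_frame_sym[OF S ef] x unfolding dual_frame_def by metis
  finally show ?thesis .
qed

lemma bij_betw_frame_op:
  assumes S: "subspace S" and ef: "dual_frame S e f" and A: "\<And>x. x \<in> S \<Longrightarrow> A x = frame_op S f (\<lambda>_. 1) x"
  shows "bij_betw A S S" and "\<And>x. x \<in> S \<Longrightarrow> inv_into S A x = frame_op S e (\<lambda>_. 1) x"
proof -
  note fe = dual_frame_sym[OF S ef]
  show bij: "bij_betw A S S"
    using frame_op_in[OF S ef] frame_op_in[OF S fe] frame_op_inverse[OF S ef] frame_op_inverse[OF S fe]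
    by (intro bij_betwI[where g = "frame_op S e (\<lambda>_. 1)"]) (auto simp: A)
  show "inv_into S A x = frame_op S e (\<lambda>_. 1) x" if "x \<in> S" for x
    using that bij frame_op_in[OF S fe, of _ x] frame_op_inverse[OF S ef that]
    by (intro inv_into_f_eq) (auto simp: A bij_betw_def)
qed

lemma bilinear_inner_linear:
  assumes "linear g" "linear h"
  shows "bilinear (\<lambda>x y. inner (g x) (h y))"
  using assms by (auto simp: bilinear_def linear_add linear_scale inner_add_left inner_add_right intro!: linearI)

lemma bilinear_selfadjoint_form:
  assumes S: "subspace S" and A: "A \<in> selfadjoint_ops S"
  shows "bilinear (\<lambda>x y. inner (A (orth_proj S x)) (orth_proj S y))"
proof -
  have "linear (\<lambda>x. A (orth_proj S x))" using A S
    by (auto simp: selfadjoint_ops_def intro: linear_on_subspace_ext)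
  then show ?thesis by (rule bilinear_inner_linear[OF _ linear_orth_proj[OF S]])
qed

lemma simultaneous_diagonalization:
  fixes A B :: "'a::euclidean_space \<Rightarrow> 'a"
  assumes S: "subspace S" and A: "A \<in> posdef_ops S" and B: "B \<in> selfadjoint_ops S"
  obtains e f \<mu> where "dual_frame S e f"
    and "\<And>x. x \<in> S \<Longrightarrow> A x = frame_op S f (\<lambda>_. 1) x"
    and "\<And>x. x \<in> S \<Longrightarrow> B x = frame_op S f \<mu> x"
proof -
  define a where "a x y = inner (A (orth_proj S x)) (orth_proj S y)" for x y
  define b where "b x y = inner (B (orth_proj S x)) (orth_proj S y)" for x y
  have A': "A \<in> selfadjoint_ops S" using A by (simp add: posdef_ops_def)
  have lA: "linear_on_subspace S S A" and lB: "linear_on_subspace S S B"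
    using A' B by (auto simp: selfadjoint_ops_def)
  have AS: "A x \<in> S" "B x \<in> S" if "x \<in> S" for x
    using lA lB that by (auto simp: linear_on_subspace_def)
  have "a x y = a y x" "b x y = b y x" for x y
    using A' B orth_proj_in[OF S] unfolding a_def b_def selfadjoint_ops_def by (auto simp: inner_commute)
  moreover have "bilinear a" "bilinear b"
    using bilinear_selfadjoint_form[OF S] A' B unfolding a_def b_def by auto
  moreover have "0 < a x x" if "x \<in> S" "x \<noteq> 0" for x
    using that A by (simp add: a_def orth_proj_id[OF S] posdef_ops_def)
  ultimately obtain e \<mu> where eS: "\<forall>l<dim S. e l \<in> S"
    and ea: "\<forall>l<dim S. \<forall>m<dim S. a (e l) (e m) = (if l = m then 1 else 0)"
    and eb: "\<forall>l<dim S. \<forall>m<dim S. b (e l) (e m) = (if l = m then \<mu> l else 0)"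
    and ex: "\<forall>x\<in>S. x = (\<Sum>l<dim S. a x (e l) *\<^sub>R e l)"
    using simultaneous_diagonalization_forms[of a b S] S by blast
  \<comment> \<open>With this choice a(x, e_l) is the inner product of x with f_l, so
    a-orthonormality of e becomes duality of e and f.\<close>
  define f where "f l = A (e l)" for l
  have af: "a x (e l) = inner x (f l)" if "x \<in> S" "l < dim S" for x l
    using that eS A' by (auto simp: a_def f_def orth_proj_id[OF S] selfadjoint_ops_def)
  have ex': "x = (\<Sum>l<dim S. inner x (f l) *\<^sub>R e l)" if "x \<in> S" for x
  proof -
    have "(\<Sum>l<dim S. inner x (f l) *\<^sub>R e l) = (\<Sum>l<dim S. a x (e l) *\<^sub>R e l)"
      using that by (intro sum.cong) (auto simp: af)
    then show ?thesis using ex that by simp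
  qed
  have Be: "B (e l) = \<mu> l *\<^sub>R f l" if l: "l < dim S" for l
  proof (rule subspace_eqI[OF S])
    show "B (e l) \<in> S" "\<mu> l *\<^sub>R f l \<in> S" using l eS AS S by (auto simp: f_def subspace_scale)
    have em: "inner (B (e l)) (e m) = inner (\<mu> l *\<^sub>R f l) (e m)" if "m < dim S" for m
    proof -
      have "inner (B (e l)) (e m) = b (e l) (e m)"
        using l that eS by (simp add: b_def orth_proj_id[OF S])
      also have "\<dots> = \<mu> l * a (e m) (e l)" using ea eb l that by auto
      also have "\<dots> = inner (\<mu> l *\<^sub>R f l) (e m)" using af eS l that by (simp add: inner_commute)
      finally show ?thesis .
    qed
    fix y assume "y \<in> S"
    note y = ex'[OF this]
    show "inner (B (e l)) y = inner (\<mu> l *\<^sub>R f l) y"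
      by (subst (1 2) y) (simp only: inner_sum_right inner_scaleR_right, rule sum.cong, auto simp: em)
  qed
  show thesis
  proof
    show "dual_frame S e f"
      using eS AS ea af ex' by (auto simp: dual_frame_def f_def)
    show "A x = frame_op S f (\<lambda>_. 1) x" if "x \<in> S" for x
    proof -
      have "A x = A (\<Sum>l<dim S. inner x (f l) *\<^sub>R e l)" using ex'[OF that] by simp
      also have "\<dots> = (\<Sum>l<dim S. inner x (f l) *\<^sub>R A (e l))"
        using eS by (intro linear_on_subspace_sum[OF S lA]) auto
      finally show ?thesis by (simp add: frame_op_def f_def)
    qed
    show "B x = frame_op S f \<mu> x" if "x \<in> S" for x
    proof -
      have "B x = B (\<Sum>l<dim S. inner x (f l) *\<^sub>R e l)" using ex'[OF that] by simp
      also have "\<dots> = (\<Sum>l<dim S. inner x (f l) *\<^sub>R B (e l))"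
        using eS by (intro linear_on_subspace_sum[OF S lB]) auto
      finally show ?thesis using Be by (simp add: frame_op_def mult.commute)
    qed
  qed
qed

lemma frame_op_coefficient:
  assumes "subspace S" "dual_frame S e f" "\<And>x. x \<in> S \<Longrightarrow> B x = frame_op S f \<mu> x" "l < dim S"
  shows "inner (B (e l)) (e l) = \<mu> l"
proof -
  have "e l \<in> S" "inner (f l) (e l) = 1" using assms(2,4) by (auto simp: dual_frame_def inner_commute)
  then show ?thesis using assms by (simp add: frame_op_dual)
qed

lemma frame_op_coefficient_pos:
  assumes "subspace S" "dual_frame S e f" "B \<in> posdef_ops S" "\<And>x. x \<in> S \<Longrightarrow> B x = frame_op S f \<mu> x" "l < dim S"
  shows "0 < \<mu> l"
proof -
  have "e l \<in> S" "e l \<noteq> 0" using assms(2,5) by (auto simp: dual_frame_def) (metis inner_zero_left zero_neq_one)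
  then have "0 < inner (B (e l)) (e l)" using assms(3) by (auto simp: posdef_ops_def)
  then show ?thesis using frame_op_coefficient[OF assms(1,2,4,5)] by simp
qed

section \<open>Log-determinants of operators diagonal in a frame\<close>

lemma orthonormal_basis_exists:
  assumes "subspace (S :: 'a::euclidean_space set)"
  shows "\<exists>bs. orthonormal_basis S bs"
proof -
  obtain C where C: "C \<subseteq> S" "pairwise real_inner_class.orthogonal C" "\<And>x. x \<in> C \<Longrightarrow> norm x = 1"
    "independent C" "card C = dim S" "span C = S"
    using orthonormal_basis_subspace[OF assms] by metis
  then obtain bs where "set bs = C" "distinct bs"
    using finite_distinct_list finiteI_independent by metis
  then have "orthonormal_basis S bs" using C
    unfolding orthonormal_basis_def by (auto simp: pairwise_def real_inner_class.orthogonal_def dot_square_norm)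
  then show ?thesis ..
qed

lemma orthonormal_basis_dual_frame:
  assumes bs: "orthonormal_basis S bs"
  shows "length bs = dim S" and "dual_frame S (\<lambda>l. bs ! l) (\<lambda>l. bs ! l)"
proof -
  have sp: "span (set bs) = S" and d: "distinct bs"
    and on: "\<And>u v. u \<in> set bs \<Longrightarrow> v \<in> set bs \<Longrightarrow> inner u v = (if u = v then 1 else 0)"
    using bs by (auto simp: orthonormal_basis_def)
  have "pairwise real_inner_class.orthogonal (set bs)" "0 \<notin> set bs"
    using on by (auto simp: pairwise_def real_inner_class.orthogonal_def) (metis inner_zero_left zero_neq_one)
  then have "independent (set bs)" by (rule pairwise_orthogonal_independent)
  then show len: "length bs = dim S" using sp d
    by (metis dim_eq_card_independent dim_span distinct_card)
  have "x = (\<Sum>l<dim S. inner x (bs ! l) *\<^sub>R bs ! l)" if "x \<in> S" for x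
  proof -
    have "x = (\<Sum>b\<in>set bs. inner x b *\<^sub>R b)"
      using that sp on by (intro orthonormal_basis_expand[symmetric])
        (auto simp: pairwise_def real_inner_class.orthogonal_def norm_eq_1)
    also have "\<dots> = (\<Sum>l<dim S. inner x (bs ! l) *\<^sub>R bs ! l)"
      using d len by (intro sum.reindex_bij_betw[OF bij_betw_nth, symmetric]) auto
    finally show ?thesis .
  qed
  then show "dual_frame S (\<lambda>l. bs ! l) (\<lambda>l. bs ! l)"
    using on d len sp by (auto simp: dual_frame_def nth_eq_iff_index_eq intro: span_base)
qed

lemma det_on_cong:
  assumes "subspace S" "\<And>x. x \<in> S \<Longrightarrow> g x = h x"
  shows "det_on S g = det_on S h"
proof -
  define bs where "bs = (SOME bs. orthonormal_basis S bs)"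
  have bs: "orthonormal_basis S bs" unfolding bs_def
    using orthonormal_basis_exists[OF assms(1)] by (rule someI_ex)
  have "bs ! s \<in> S" if "s < length bs" for s
    using orthonormal_basis_dual_frame[OF bs] that by (auto simp: dual_frame_def)
  then have "Matrix.mat (length bs) (length bs) (\<lambda>(r, s). inner (bs ! r) (g (bs ! s))) =
      Matrix.mat (length bs) (length bs) (\<lambda>(r, s). inner (bs ! r) (h (bs ! s)))"
    using assms(2) by (intro eq_matI) auto
  then show ?thesis unfolding det_on_def Let_def bs_def[symmetric] by simp
qed

text \<open>In the orthonormal basis chosen by \<open>det_on\<close> the matrix is M
  diag(\<open>\<mu>\<close>) M^T, where the columns of M are the coordinates of the f_l. The factor
  (det M)^2 is common to all weights; since only differences of log-determinants in one frame are
  compared, its value is left open.\<close>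

lemma det_on_frame_op:
  assumes S: "subspace S" and ef: "dual_frame S e f"
  obtains D where "0 < D" "\<And>\<mu>. det_on S (frame_op S f \<mu>) = D * (\<Prod>l<dim S. \<mu> l)"
proof -
  define bs where "bs = (SOME bs. orthonormal_basis S bs)"
  define n where "n = dim S"
  have bs: "orthonormal_basis S bs" unfolding bs_def
    using orthonormal_basis_exists[OF S] by (rule someI_ex)
  note len = orthonormal_basis_dual_frame(1)[OF bs] and fr = orthonormal_basis_dual_frame(2)[OF bs]
  define M where "M = Matrix.mat n n (\<lambda>(r, l). inner (bs ! r) (f l))"
  define N where "N = Matrix.mat n n (\<lambda>(l, r). inner (e l) (bs ! r))"
  define D where "D \<mu> = Matrix.mat n n (\<lambda>(l, m). if l = m then \<mu> l else 0)" for \<mu> :: "nat \<Rightarrow> real"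
  have carr: "M \<in> carrier_mat n n" "N \<in> carrier_mat n n" "D \<mu> \<in> carrier_mat n n" for \<mu>
    by (auto simp: M_def N_def D_def)
  have NM: "N * M = 1\<^sub>m n"
  proof (rule eq_matI)
    fix l m assume lm: "l < dim_row (1\<^sub>m n :: real mat)" "m < dim_col (1\<^sub>m n :: real mat)"
    then have "(N * M) $$ (l, m) = (\<Sum>r<n. inner (e l) (bs ! r) * inner (bs ! r) (f m))"
      by (simp add: M_def N_def times_mat_def scalar_prod_def atLeast0LessThan)
    also have "\<dots> = inner (\<Sum>r<n. inner (e l) (bs ! r) *\<^sub>R bs ! r) (f m)"
      by (simp add: inner_sum_left)
    also have "\<dots> = inner (e l) (f m)"
      using fr ef lm unfolding dual_frame_def n_def by simp
    also have "\<dots> = 1\<^sub>m n $$ (l, m)" using ef lm by (simp add: dual_frame_def n_def)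
    finally show "(N * M) $$ (l, m) = 1\<^sub>m n $$ (l, m)" .
  qed (auto simp: M_def N_def)
  have detM: "Determinant.det M \<noteq> 0"
    using arg_cong[OF NM, of Determinant.det] det_mult[OF carr(2,1)] by auto
  have "det_on S (frame_op S f \<mu>) = (Determinant.det M)\<^sup>2 * (\<Prod>l<dim S. \<mu> l)" for \<mu>
  proof -
    have "Matrix.mat n n (\<lambda>(r, s). inner (bs ! r) (frame_op S f \<mu> (bs ! s))) = M * D \<mu> * transpose_mat M"
    proof (rule eq_matI)
      fix r s assume "r < dim_row (M * D \<mu> * transpose_mat M)" "s < dim_col (M * D \<mu> * transpose_mat M)"
      then have rs: "r < n" "s < n" by (auto simp: M_def)
      have MD: "(M * D \<mu>) $$ (r, l) = inner (bs ! r) (f l) * \<mu> l" if "l < n" for l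
      proof -
        have "(M * D \<mu>) $$ (r, l) = (\<Sum>i<n. inner (bs ! r) (f i) * (if i = l then \<mu> i else 0))"
          using rs that by (simp add: M_def D_def times_mat_def scalar_prod_def atLeast0LessThan)
        also have "\<dots> = (\<Sum>i<n. if i = l then inner (bs ! r) (f i) * \<mu> i else 0)"
          by (intro sum.cong) auto
        finally show ?thesis using that by simp
      qed
      have "(M * D \<mu> * transpose_mat M) $$ (r, s) = (\<Sum>l<n. (M * D \<mu>) $$ (r, l) * M $$ (s, l))"
        using rs carr by (simp add: times_mat_def scalar_prod_def atLeast0LessThan M_def D_def)
      also have "\<dots> = (\<Sum>l<n. inner (bs ! r) (f l) * \<mu> l * inner (bs ! s) (f l))"
        using rs by (intro sum.cong) (auto simp: MD, simp add: M_def)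
      also have "\<dots> = inner (bs ! r) (frame_op S f \<mu> (bs ! s))"
        by (subst inner_commute) (simp add: inner_frame_op n_def algebra_simps)
      finally show "Matrix.mat n n (\<lambda>(r, s). inner (bs ! r) (frame_op S f \<mu> (bs ! s))) $$ (r, s) =
          (M * D \<mu> * transpose_mat M) $$ (r, s)" using rs by simp
    qed (auto simp: M_def)
    moreover have "Determinant.det (D \<mu>) = (\<Prod>l<n. \<mu> l)"
    proof -
      have "upper_triangular (D \<mu>)" by (auto simp: upper_triangular_def D_def)
      then have "Determinant.det (D \<mu>) = prod_list (diag_mat (D \<mu>))"
        using det_upper_triangular carr by blast
      then show ?thesis by (simp add: prod_list_diag_prod D_def atLeast0LessThan)
    qed
    ultimately show ?thesis
      unfolding det_on_def Let_def bs_def[symmetric] len n_def[symmetric]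
      using carr by (simp add: det_mult[of _ n] det_transpose power2_eq_square mult_ac)
  qed
  then show thesis using that detM by (metis zero_less_power2)
qed

lemma ln_det_on_frame_op:
  assumes S: "subspace S" and ef: "dual_frame S e f"
    and A: "\<And>x. x \<in> S \<Longrightarrow> A x = frame_op S f (\<lambda>_. 1) x"
    and B: "\<And>x. x \<in> S \<Longrightarrow> B x = frame_op S f \<mu> x"
    and \<mu>: "\<And>l. l < dim S \<Longrightarrow> 0 < \<mu> l"
  shows "ln (det_on S B) = ln (det_on S A) + (\<Sum>l<dim S. ln (\<mu> l))"
proof -
  obtain D where D: "0 < D" "\<And>\<mu>. det_on S (frame_op S f \<mu>) = D * (\<Prod>l<dim S. \<mu> l)"
    using det_on_frame_op[OF S ef] by blast
  have "det_on S A = D" "det_on S B = D * (\<Prod>l<dim S. \<mu> l)"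
    using det_on_cong[OF S A] det_on_cong[OF S B] D by auto
  moreover have "0 < (\<Prod>l<dim S. \<mu> l)" using \<mu> by (intro prod_pos) auto
  moreover have "ln (\<Prod>l<dim S. \<mu> l) = (\<Sum>l<dim S. ln (\<mu> l))" using \<mu> by (intro ln_prod) fastforce+
  ultimately show ?thesis using D(1) ln_mult[of D "\<Prod>l<dim S. \<mu> l"] by (metis less_irrefl)
qed

lemma diagonalize_family:
  assumes V: "\<And>i. V i \<in> posdef_ops (S i)" and H: "\<And>i. H i \<in> selfadjoint_ops (S i)"
    and S: "\<And>i. subspace (S i)"
  obtains e f \<mu> where "\<And>i. dual_frame (S i) (e i) (f i)"
    and "\<And>i x. x \<in> S i \<Longrightarrow> V i x = frame_op (S i) (f i) (\<lambda>_. 1) x"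
    and "\<And>i x. x \<in> S i \<Longrightarrow> H i x = frame_op (S i) (f i) (\<mu> i) x"
proof -
  have "\<forall>i. \<exists>e f \<mu>. dual_frame (S i) e f \<and> (\<forall>x\<in>S i. V i x = frame_op (S i) f (\<lambda>_. 1) x) \<and>
      (\<forall>x\<in>S i. H i x = frame_op (S i) f \<mu> x)"
    using simultaneous_diagonalization[OF S V H] by metis
  then obtain e f \<mu> where "\<forall>i. dual_frame (S i) (e i) (f i) \<and>
      (\<forall>x\<in>S i. V i x = frame_op (S i) (f i) (\<lambda>_. 1) x) \<and> (\<forall>x\<in>S i. H i x = frame_op (S i) (f i) (\<mu> i) x)"
    by metis
  then show thesis using that by blast
qed

subsection \<open>Positive semidefinite operators\<close>

text \<open>Simultaneous diagonalization with the identity: the operator with unit weights maps e_l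
  to f_l, so here f = e and the frame is orthonormal.\<close>

lemma psd_spectral:
  assumes S: "subspace S" and P: "P \<in> possemidef_ops S"
  obtains e \<mu> where "dual_frame S e e" and "\<And>l. l < dim S \<Longrightarrow> 0 \<le> \<mu> l"
    and "\<And>x. x \<in> S \<Longrightarrow> P x = frame_op S e \<mu> x"
proof -
  have id: "(\<lambda>x. x) \<in> posdef_ops S"
    by (auto simp: posdef_ops_def selfadjoint_ops_def linear_on_subspace_def)
  have P': "P \<in> selfadjoint_ops S" using P by (simp add: possemidef_ops_def)
  obtain e f \<mu> where ef: "dual_frame S e f"
    and I: "\<And>x. x \<in> S \<Longrightarrow> x = frame_op S f (\<lambda>_. 1) x"
    and Pf: "\<And>x. x \<in> S \<Longrightarrow> P x = frame_op S f \<mu> x"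
    using simultaneous_diagonalization[OF S id P'] by metis
  have fe: "f l = e l" if "l < dim S" for l
    using I[of "e l"] frame_op_dual[OF S ef that, of "\<lambda>_. 1"] ef that by (simp add: dual_frame_def)
  have ee: "dual_frame S e e" using ef by (simp add: dual_frame_def fe)
  have fop: "frame_op S f \<mu> x = frame_op S e \<mu> x" for x by (simp add: frame_op_def fe)
  have "0 \<le> \<mu> l" if l: "l < dim S" for l
  proof -
    have "e l \<in> S" using ee l by (simp add: dual_frame_def)
    then show ?thesis using frame_op_coefficient[OF S ef Pf l] P by (auto simp: possemidef_ops_def)
  qed
  then show thesis using that ee Pf fop by metis
qed

text \<open>One-sided version, for directions in a cone: divide by 2 s and let s tend to 0 from
  above.\<close>

lemma quadratic_nonneg_imp_slope_nonneg:
  fixes p r :: real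
  assumes "\<And>s. 0 < s \<Longrightarrow> s \<le> 1 \<Longrightarrow> 0 \<le> 2 * s * p + s\<^sup>2 * r"
  shows "0 \<le> p"
proof (rule tendsto_lowerbound)
  show "((\<lambda>s. p + s * r / 2) \<longlongrightarrow> p) (at_right 0)"
    by (auto intro!: tendsto_eq_intros)
  have "0 \<le> p + s * r / 2" if "0 < s" "s \<le> 1" for s
  proof -
    have "0 \<le> 2 * s * (p + s * r / 2)" using assms[OF that] by (simp add: algebra_simps power2_eq_square)
    then show ?thesis using that by (simp add: zero_le_mult_iff)
  qed
  then show "\<forall>\<^sub>F s in at_right 0. 0 \<le> p + s * r / 2"
    by (auto simp: eventually_at_right_field intro!: exI[of _ 1])
qed simp

text \<open>The dual condition is that of Farkas' lemma for the cone of positive semidefinite operators.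
  The coercivity condition, a Slater condition, makes the image of the cone closed, so that the
  operator can be found by minimizing the squared distance to the target values.\<close>

lemma psd_moment_problem:
  fixes x y :: "'r \<Rightarrow> 'a::euclidean_space" and \<tau> :: "'r \<Rightarrow> real"
  assumes R: "finite R"
    and dual: "\<And>\<rho>. (\<And>z. 0 \<le> (\<Sum>r\<in>R. \<rho> r * inner (x r) z * inner (y r) z)) \<Longrightarrow>
      0 \<le> (\<Sum>r\<in>R. \<rho> r * \<tau> r)"
    and coercive: "\<And>z. inner z z \<le> (\<Sum>r\<in>R. \<sigma> r * inner (x r) z * inner (y r) z)"
  obtains P where "P \<in> possemidef_ops UNIV" "linear P" "\<And>r. r \<in> R \<Longrightarrow> inner (P (x r)) (y r) = \<tau> r"
proof -
  \<comment> \<open>Bounded linear maps form a finite-dimensional normed space, in which closed and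
    bounded sets are compact; this is what the minimization of \<open>\<Phi>\<close> rests
    on.\<close>
  define C :: "('a \<Rightarrow>\<^sub>L 'a) set" where
    "C = {Q. (\<forall>u v. inner (blinfun_apply Q u) v = inner u (blinfun_apply Q v)) \<and> (\<forall>u. 0 \<le> inner (blinfun_apply Q u) u)}"
  define \<Phi> where "\<Phi> Q = (\<Sum>r\<in>R. (inner (blinfun_apply Q (x r)) (y r) - \<tau> r)\<^sup>2)" for Q :: "'a \<Rightarrow>\<^sub>L 'a"
  define K where "K = {Q \<in> C. \<Phi> Q \<le> \<Phi> 0}"
  have Cpsd: "blinfun_apply Q \<in> possemidef_ops UNIV" if "Q \<in> C" for Q
    using that by (auto simp: C_def possemidef_ops_def selfadjoint_ops_def linear_on_subspace_def
        blinfun.add_right blinfun.scaleR_right)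
  have cont: "continuous_on UNIV \<Phi>"
    unfolding \<Phi>_def by (intro continuous_intros)
  have "closed C" unfolding C_def
    by (intro closed_Collect_conj closed_Collect_all closed_Collect_eq closed_Collect_le continuous_intros)
  then have "closed K" unfolding K_def
    using closed_Collect_le[OF cont continuous_on_const[of _ "\<Phi> 0"]]
    by (simp add: Collect_conj_eq closed_Int)
  moreover have "bounded K"
  proof -
    \<comment> \<open>M bounds the trace. Coercivity at the eigenvectors bounds the trace of Q by a
      combination of its moments, and on K each moment lies within sqrt(\<open>\<Phi> 0\<close>) of
      its target. For a positive semidefinite Q the trace in turn bounds the norm.\<close>
    define M where "M = (\<Sum>r\<in>R. \<bar>\<sigma> r\<bar> * (\<bar>\<tau> r\<bar> + sqrt (\<Phi> 0)))"
    have "norm Q \<le> M" if Q: "Q \<in> K" for Q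
    proof -
      have QC: "Q \<in> C" "\<Phi> Q \<le> \<Phi> 0" using Q by (auto simp: K_def)
      obtain e \<mu> where e: "dual_frame UNIV e e" and \<mu>: "\<And>l. l < dim (UNIV :: 'a set) \<Longrightarrow> 0 \<le> \<mu> l"
        and Qe: "\<And>x. Q x = frame_op UNIV e \<mu> x"
        using psd_spectral[OF subspace_UNIV Cpsd[OF QC(1)]] by (metis UNIV_I)
      let ?n = "dim (UNIV :: 'a set)"
      have e1: "inner (e l) (e l) = 1" if "l < ?n" for l using e that by (simp add: dual_frame_def)
      have "(\<Sum>l<?n. \<mu> l) = (\<Sum>l<?n. \<mu> l * inner (e l) (e l))" using e1 by simp
      also have "\<dots> \<le> (\<Sum>l<?n. \<mu> l * (\<Sum>r\<in>R. \<sigma> r * inner (x r) (e l) * inner (y r) (e l)))"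
        using \<mu> coercive by (intro sum_mono mult_left_mono) auto
      also have "\<dots> = (\<Sum>r\<in>R. \<sigma> r * inner (Q (x r)) (y r))"
        by (simp add: Qe inner_frame_op sum_distrib_left sum.swap[of _ R] algebra_simps)
      also have "\<dots> \<le> M" unfolding M_def
      proof (rule sum_mono)
        fix r assume r: "r \<in> R"
        have "(inner (Q (x r)) (y r) - \<tau> r)\<^sup>2 \<le> \<Phi> Q"
          unfolding \<Phi>_def using R r by (intro member_le_sum) auto
        then have "\<bar>inner (Q (x r)) (y r) - \<tau> r\<bar> \<le> sqrt (\<Phi> 0)"
          using QC(2) by (intro real_le_rsqrt) simp
        then have "\<bar>inner (Q (x r)) (y r)\<bar> \<le> \<bar>\<tau> r\<bar> + sqrt (\<Phi> 0)" by linarith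
        then have "\<bar>\<sigma> r * inner (Q (x r)) (y r)\<bar> \<le> \<bar>\<sigma> r\<bar> * (\<bar>\<tau> r\<bar> + sqrt (\<Phi> 0))"
          by (simp add: abs_mult mult_left_mono)
        then show "\<sigma> r * inner (Q (x r)) (y r) \<le> \<bar>\<sigma> r\<bar> * (\<bar>\<tau> r\<bar> + sqrt (\<Phi> 0))" by linarith
      qed
      finally have tr: "(\<Sum>l<?n. \<mu> l) \<le> M" .
      have "norm (Q u) \<le> M * norm u" for u
      proof -
        have "norm (Q u) \<le> (\<Sum>l<?n. \<mu> l * norm u)" unfolding Qe frame_op_def
        proof (rule sum_norm_le)
          fix l assume "l \<in> {..<?n}"
          then have l: "l < ?n" by simp
          have "norm (e l) = 1" using e1[OF l] by (simp add: norm_eq_1)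
          then show "norm ((\<mu> l * inner u (e l)) *\<^sub>R e l) \<le> \<mu> l * norm u"
            using \<mu>[OF l] Cauchy_Schwarz_ineq2[of u "e l"] by (simp add: abs_mult mult_left_mono)
        qed
        also have "\<dots> \<le> M * norm u" using tr by (simp add: sum_distrib_right[symmetric] mult_right_mono)
        finally show ?thesis .
      qed
      moreover have "0 \<le> M" using tr \<mu> by (meson lessThan_iff order_trans sum_nonneg)
      ultimately show ?thesis by (intro norm_blinfun_bound) auto
    qed
    then show ?thesis by (auto simp: bounded_iff)
  qed
  ultimately have "compact K" by (simp add: compact_eq_bounded_closed)
  moreover have "0 \<in> K" by (simp add: K_def C_def)
  ultimately obtain Q0 where Q0: "Q0 \<in> K" and "\<And>Q. Q \<in> K \<Longrightarrow> \<Phi> Q0 \<le> \<Phi> Q"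
    using continuous_attains_inf[of K \<Phi>] continuous_on_subset[OF cont] by blast
  then have min: "\<Phi> Q0 \<le> \<Phi> Q" if "Q \<in> C" for Q
    using that by (cases "\<Phi> Q \<le> \<Phi> 0") (auto simp: K_def)
  have Q0C: "Q0 \<in> C" using Q0 by (simp add: K_def)
  define \<rho> where "\<rho> r = inner (Q0 (x r)) (y r) - \<tau> r" for r
  \<comment> \<open>First-order condition at the minimizer, for every direction in which one can
    move a unit step inside the cone. The residuals \<open>\<rho>\<close> are the gradient, up to a
    factor 2.\<close>
  have variation: "0 \<le> (\<Sum>r\<in>R. \<rho> r * inner (D (x r)) (y r))"
    if D: "\<And>s. 0 < s \<Longrightarrow> s \<le> 1 \<Longrightarrow> Q0 + s *\<^sub>R D \<in> C" for D :: "'a \<Rightarrow>\<^sub>L 'a"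
  proof (rule quadratic_nonneg_imp_slope_nonneg)
    fix s :: real assume s: "0 < s" "s \<le> 1"
    have "\<Phi> (Q0 + s *\<^sub>R D) = (\<Sum>r\<in>R. (\<rho> r + s * inner (D (x r)) (y r))\<^sup>2)"
      by (simp add: \<Phi>_def \<rho>_def blinfun.add_left blinfun.scaleR_left inner_add_left algebra_simps)
    also have "\<dots> = \<Phi> Q0 + 2 * s * (\<Sum>r\<in>R. \<rho> r * inner (D (x r)) (y r))
        + s\<^sup>2 * (\<Sum>r\<in>R. (inner (D (x r)) (y r))\<^sup>2)"
      by (simp add: \<Phi>_def \<rho>_def[symmetric] power2_sum sum.distrib sum_distrib_left power_mult_distrib mult_ac)
    finally show "0 \<le> 2 * s * (\<Sum>r\<in>R. \<rho> r * inner (D (x r)) (y r)) + s\<^sup>2 * (\<Sum>r\<in>R. (inner (D (x r)) (y r))\<^sup>2)"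
      using min[OF D[OF s]] by linarith
  qed
  \<comment> \<open>Rank-one directions z z^T stay in the cone, so the residuals are admissible
    coefficients in \<open>dual\<close>.\<close>
  have "0 \<le> (\<Sum>r\<in>R. \<rho> r * inner (x r) z * inner (y r) z)" for z
  proof -
    define D where "D = Blinfun (\<lambda>u. inner u z *\<^sub>R z)"
    have "bounded_linear (\<lambda>u. inner u z *\<^sub>R z)"
      by (intro bounded_linear_intros)
    then have D: "D u = inner u z *\<^sub>R z" for u
      by (simp add: D_def bounded_linear_Blinfun_apply)
    have sq: "0 \<le> s * (inner u z * inner u z)" if "0 < s" for s u using that by simp
    have "0 \<le> (\<Sum>r\<in>R. \<rho> r * inner (D (x r)) (y r))"
      using Q0C sq by (intro variation)
        (auto simp: C_def D blinfun.add_left blinfun.scaleR_left inner_add_left inner_add_right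
          inner_commute mult.assoc intro!: add_nonneg_nonneg)
    then show ?thesis by (simp add: D inner_commute mult_ac)
  qed
  then have "0 \<le> (\<Sum>r\<in>R. \<rho> r * \<tau> r)" by (rule dual)
  \<comment> \<open>Moving towards the apex stays in the cone up to s = 1. Together with the
    inequality from \<open>dual\<close> it makes the sum of the squared residuals
    nonpositive.\<close>
  moreover have "0 \<le> (\<Sum>r\<in>R. \<rho> r * inner ((- Q0) (x r)) (y r))"
  proof (rule variation)
    fix s :: real assume "0 < s" "s \<le> 1"
    moreover have "Q0 + s *\<^sub>R (- Q0) = (1 - s) *\<^sub>R Q0" by (simp add: algebra_simps)
    ultimately show "Q0 + s *\<^sub>R (- Q0) \<in> C"
      using Q0C by (auto simp: C_def blinfun.scaleR_left)
  qed
  ultimately have "(\<Sum>r\<in>R. \<rho> r * (inner (Q0 (x r)) (y r) - \<tau> r)) \<le> 0"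
    by (simp add: blinfun.minus_left sum_negf algebra_simps sum_subtractf)
  then have "(\<Sum>r\<in>R. (\<rho> r)\<^sup>2) \<le> 0" by (simp add: \<rho>_def power2_eq_square)
  then have "\<rho> r = 0" if "r \<in> R" for r
    using R that sum_nonneg_eq_0_iff[of R "\<lambda>r. (\<rho> r)\<^sup>2"] sum_nonneg[of R "\<lambda>r. (\<rho> r)\<^sup>2"] by auto
  then show thesis
    using Cpsd[OF Q0C] by (intro that[of Q0])
      (auto simp: \<rho>_def blinfun.bounded_linear_right[THEN bounded_linear.linear])
qed

lemma posdef_ops_cong:
  assumes "\<And>x. x \<in> S \<Longrightarrow> f x = g x" "f \<in> posdef_ops S" "subspace S"
  shows "g \<in> posdef_ops S"
  using assms by (auto simp: posdef_ops_def selfadjoint_ops_def linear_on_subspace_def subspace_add subspace_scale)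

lemma posdef_imp_selfadjoint: "A \<in> posdef_ops S \<Longrightarrow> A \<in> selfadjoint_ops S"
  by (simp add: posdef_ops_def)

lemma selfadjoint_ops_in: "A \<in> selfadjoint_ops S \<Longrightarrow> x \<in> S \<Longrightarrow> A x \<in> S"
  by (simp add: selfadjoint_ops_def linear_on_subspace_def)

lemma posdef_inverse:
  assumes S: "subspace S" and A: "A \<in> posdef_ops S"
  shows "bij_betw A S S" and "inv_into S A \<in> posdef_ops S"
proof -
  obtain e f \<mu> where ef: "dual_frame S e f" and Af: "\<And>x. x \<in> S \<Longrightarrow> A x = frame_op S f (\<lambda>_. 1) x"
    using simultaneous_diagonalization[OF S A posdef_imp_selfadjoint[OF A]] by metis
  show "bij_betw A S S" by (rule bij_betw_frame_op[OF S ef Af])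
  show "inv_into S A \<in> posdef_ops S"
    using bij_betw_frame_op(2)[OF S ef Af] posdef_frame_op[OF S dual_frame_sym[OF S ef], of "\<lambda>_. 1"]
    by - (rule posdef_ops_cong[OF _ _ S, of "frame_op S e (\<lambda>_. 1)"], auto)
qed

text \<open>A zero eigenvalue would put a nonzero eigenvector in the kernel.\<close>

lemma possemidef_inj_imp_posdef:
  assumes S: "subspace S" and P: "P \<in> possemidef_ops S" and inj: "inj_on P S"
  shows "P \<in> posdef_ops S"
proof -
  obtain e \<mu> where e: "dual_frame S e e" and \<mu>: "\<And>l. l < dim S \<Longrightarrow> 0 \<le> \<mu> l"
    and Pe: "\<And>x. x \<in> S \<Longrightarrow> P x = frame_op S e \<mu> x"
    using psd_spectral[OF S P] by metis
  have "0 < \<mu> l" if l: "l < dim S" for l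
  proof (rule ccontr)
    assume "\<not> 0 < \<mu> l"
    then have "\<mu> l = 0" using \<mu>[OF l] by simp
    moreover have el: "e l \<in> S" "e l \<noteq> 0"
      using e l by (auto simp: dual_frame_def) (metis inner_zero_left zero_neq_one)
    ultimately have "P (e l) = 0" using Pe frame_op_dual[OF S e l] by simp
    moreover have "P 0 = 0" using Pe[of 0] S by (simp add: subspace_0 frame_op_def)
    ultimately show False using inj_onD[OF inj _ el(1) subspace_0[OF S]] el(2) by simp
  qed
  then have "frame_op S e \<mu> \<in> posdef_ops S" using posdef_frame_op[OF S e] by blast
  then show ?thesis using Pe by - (rule posdef_ops_cong[OF _ _ S, of "frame_op S e \<mu>"], auto)
qed

text \<open>A form of the operator monotonicity of the square root.\<close>

lemma geometric_mean_form_le: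
  fixes f e :: "'s \<Rightarrow> 'a::euclidean_space" and k :: "'r \<Rightarrow> 'a"
  assumes fin: "finite I" "finite J" and T: "subspace T"
    and e: "\<And>s. s \<in> I \<Longrightarrow> e s \<in> T"
    and ef: "\<And>s t. s \<in> I \<Longrightarrow> t \<in> I \<Longrightarrow> inner (e s) (f t) = (if s = t then 1 else 0)"
    and total: "\<And>x. x \<in> T \<Longrightarrow> (\<And>s. s \<in> I \<Longrightarrow> inner x (f s) = 0) \<Longrightarrow> x = 0"
    and c: "\<And>s. s \<in> I \<Longrightarrow> 0 < c s" and d: "\<And>r. r \<in> J \<Longrightarrow> 0 < d r"
    and \<mu>: "\<And>s. s \<in> I \<Longrightarrow> 0 \<le> \<mu> s"
    and le0: "\<And>x. x \<in> T \<Longrightarrow> (\<Sum>r\<in>J. d r * (inner x (k r))\<^sup>2) \<le> (\<Sum>s\<in>I. c s * (inner x (f s))\<^sup>2)"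
    and le1: "\<And>x. x \<in> T \<Longrightarrow>
      (\<Sum>r\<in>J. d r * (\<nu> r)\<^sup>2 * (inner x (k r))\<^sup>2) \<le> (\<Sum>s\<in>I. c s * (\<mu> s)\<^sup>2 * (inner x (f s))\<^sup>2)"
    and x: "x \<in> T"
  shows "(\<Sum>r\<in>J. d r * \<nu> r * (inner x (k r))\<^sup>2) \<le> (\<Sum>s\<in>I. c s * \<mu> s * (inner x (f s))\<^sup>2)"
proof -
  define q where "q x y = (\<Sum>s\<in>I. c s * inner x (f s) * inner y (f s))" for x y
  \<comment> \<open>The claim is that D is nonpositive on T. It is diagonalized relative to q, the
    form with weights c, so that a violation shows up as a positive eigenvalue.\<close>
  define D where "D x y = (\<Sum>r\<in>J. d r * \<nu> r * inner x (k r) * inner y (k r))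
    - (\<Sum>s\<in>I. c s * \<mu> s * inner x (f s) * inner y (f s))" for x y
  have q: "bilinear q" unfolding q_def bilinear_def
    by (auto intro!: linearI simp: inner_add_left algebra_simps sum.distrib sum_distrib_left)
  have D: "bilinear D" unfolding D_def bilinear_def
    by (auto intro!: linearI simp: inner_add_left algebra_simps sum.distrib sum_distrib_left)
  have qsym: "q x y = q y x" and Dsym: "D x y = D y x" for x y
    by (simp_all add: q_def D_def mult_ac)
  have qpos: "0 < q x x" if "x \<in> T" "x \<noteq> 0" for x
  proof -
    obtain s where "s \<in> I" "inner x (f s) \<noteq> 0" using total \<open>x \<in> T\<close> \<open>x \<noteq> 0\<close> by blast
    then have "0 < (\<Sum>s\<in>I. c s * (inner x (f s))\<^sup>2)"
      using fin c by (intro sum_pos2[of _ s]) (auto simp: less_imp_le)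
    then show ?thesis by (simp add: q_def power2_eq_square mult.assoc)
  qed
  obtain g \<theta> where gT: "\<forall>l<dim T. g l \<in> T"
    and gq: "\<forall>l<dim T. \<forall>m<dim T. q (g l) (g m) = (if l = m then 1 else 0)"
    and gD: "\<forall>l<dim T. \<forall>m<dim T. D (g l) (g m) = (if l = m then \<theta> l else 0)"
    and gx: "\<forall>x\<in>T. x = (\<Sum>l<dim T. q x (g l) *\<^sub>R g l)"
    using simultaneous_diagonalization_forms[OF q D qsym Dsym T qpos] by blast
  have Dg: "D (g l) y = \<theta> l * q (g l) y" if l: "l < dim T" and y: "y \<in> T" for l y
  proof -
    interpret D: linear "D (g l)" using D by (simp add: bilinear_def)
    have "D (g l) y = D (g l) (\<Sum>m<dim T. q y (g m) *\<^sub>R g m)" using gx y by simp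
    also have "\<dots> = (\<Sum>m<dim T. if m = l then \<theta> l * q y (g l) else 0)"
      unfolding D.sum D.scale using gD l by (intro sum.cong) auto
    finally show ?thesis using l qsym by simp
  qed
  have \<theta>: "\<theta> l \<le> 0" if l: "l < dim T" for l
  proof (rule ccontr)
    assume "\<not> \<theta> l \<le> 0"
    then have pos: "0 < \<theta> l" by simp
    define z where "z = g l"
    have zT: "z \<in> T" using gT l by (simp add: z_def)
    \<comment> \<open>As in the proof that A^2 <= B^2 implies A <= B. At the eigenvector z the form
      with weights d \<open>\<nu>\<close> acts like the diagonal one with weights c
      (\<open>\<mu>\<close> + \<open>\<theta> l\<close>), so this y makes the mixed term in z and y
      equal to Y, the value of q at y.\<close>
    define y where "y = (\<Sum>s\<in>I. ((\<mu> s + \<theta> l) * inner z (f s)) *\<^sub>R e s)"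
    have yT: "y \<in> T" unfolding y_def using e T by (intro subspace_sum subspace_scale)
    have yf: "inner y (f t) = (\<mu> t + \<theta> l) * inner z (f t)" if "t \<in> I" for t
    proof -
      have "inner y (f t) = (\<Sum>s\<in>I. if s = t then (\<mu> t + \<theta> l) * inner z (f t) else 0)"
        unfolding y_def inner_sum_left inner_scaleR_left using that ef by (intro sum.cong) auto
      then show ?thesis using that fin by simp
    qed
    define Y where "Y = (\<Sum>s\<in>I. c s * (inner y (f s))\<^sup>2)"
    define Z where "Z = (\<Sum>s\<in>I. c s * (\<mu> s)\<^sup>2 * (inner z (f s))\<^sup>2)"
    have "(\<Sum>r\<in>J. d r * \<nu> r * inner z (k r) * inner y (k r)) =
        (\<Sum>s\<in>I. c s * \<mu> s * inner z (f s) * inner y (f s)) + \<theta> l * q z y"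
      using Dg[OF l yT] by (simp add: D_def z_def)
    also have "\<dots> = (\<Sum>s\<in>I. c s * ((\<mu> s + \<theta> l) * inner z (f s)) * inner y (f s))"
      by (simp add: q_def sum.distrib sum_distrib_left algebra_simps)
    also have "\<dots> = Y" unfolding Y_def by (intro sum.cong) (auto simp: yf power2_eq_square)
    finally have NY: "(\<Sum>r\<in>J. d r * \<nu> r * inner z (k r) * inner y (k r)) = Y" .
    \<comment> \<open>Expanding this square and applying \<open>le1\<close> to z and
      \<open>le0\<close> to y gives Y <= Z. But the coordinates of y are those of z times
      \<open>\<mu>\<close> + \<open>\<theta> l\<close> with \<open>\<theta> l\<close> positive,
      which makes Y exceed Z by at least \<open>\<theta> l\<close> squared times q(z, z).\<close>
    have "0 \<le> (\<Sum>r\<in>J. d r * (\<nu> r * inner z (k r) - inner y (k r))\<^sup>2)"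
      using d by (intro sum_nonneg) (auto simp: less_imp_le)
    also have "\<dots> = (\<Sum>r\<in>J. d r * (\<nu> r)\<^sup>2 * (inner z (k r))\<^sup>2) + (\<Sum>r\<in>J. d r * (inner y (k r))\<^sup>2)
        - 2 * (\<Sum>r\<in>J. d r * \<nu> r * inner z (k r) * inner y (k r))"
      by (simp add: power2_diff right_diff_distrib distrib_left sum.distrib sum_subtractf sum_distrib_left
          power_mult_distrib mult_ac)
    also have "\<dots> \<le> Z + Y - 2 * Y" using le1[OF zT] le0[OF yT] by (simp add: NY Z_def Y_def)
    finally have "Y \<le> Z" by simp
    moreover have "Y - Z \<ge> (\<theta> l)\<^sup>2 * q z z"
    proof -
      have "(\<theta> l)\<^sup>2 * q z z = (\<Sum>s\<in>I. c s * ((\<theta> l)\<^sup>2 * (inner z (f s))\<^sup>2))"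
        by (simp add: q_def sum_distrib_left power2_eq_square mult_ac)
      also have "\<dots> \<le> (\<Sum>s\<in>I. c s * ((\<mu> s + \<theta> l)\<^sup>2 * (inner z (f s))\<^sup>2 - (\<mu> s)\<^sup>2 * (inner z (f s))\<^sup>2))"
      proof (rule sum_mono)
        fix s assume s: "s \<in> I"
        have "0 \<le> 2 * \<mu> s * \<theta> l * (inner z (f s))\<^sup>2" using \<mu>[OF s] pos by simp
        then have "(\<theta> l)\<^sup>2 * (inner z (f s))\<^sup>2 \<le> (\<mu> s + \<theta> l)\<^sup>2 * (inner z (f s))\<^sup>2 - (\<mu> s)\<^sup>2 * (inner z (f s))\<^sup>2"
          by (simp add: power2_eq_square algebra_simps)
        then show "c s * ((\<theta> l)\<^sup>2 * (inner z (f s))\<^sup>2)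
            \<le> c s * ((\<mu> s + \<theta> l)\<^sup>2 * (inner z (f s))\<^sup>2 - (\<mu> s)\<^sup>2 * (inner z (f s))\<^sup>2)"
          using c[OF s] by (simp add: mult_left_mono)
      qed
      also have "\<dots> = Y - Z" unfolding Y_def Z_def sum_subtractf[symmetric]
        by (intro sum.cong) (auto simp: yf power_mult_distrib right_diff_distrib mult_ac)
      finally show ?thesis .
    qed
    moreover have "(\<theta> l)\<^sup>2 * q z z > 0" using gq l pos by (simp add: z_def)
    ultimately show False by linarith
  qed
  have "D x x \<le> 0"
  proof -
    interpret Dx: linear "D x" using D by (simp add: bilinear_def)
    have "D x x = D x (\<Sum>l<dim T. q x (g l) *\<^sub>R g l)" using gx x by simp
    also have "\<dots> = (\<Sum>l<dim T. \<theta> l * (q x (g l))\<^sup>2)"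
      unfolding Dx.sum Dx.scale using Dg[OF _ x] Dsym[of x] qsym[of x]
      by (intro sum.cong) (auto simp: power2_eq_square)
    also have "\<dots> \<le> 0" using \<theta> by (intro sum_nonpos) (auto intro: mult_nonpos_nonneg)
    finally show ?thesis .
  qed
  then show ?thesis by (simp add: D_def power2_eq_square mult.assoc)
qed

lemma powr_difference_quotient_tendsto_ln:
  assumes "(0::real) < a"
  shows "(\<lambda>n. (a powr ((1/2) ^ n) - 1) / (1/2) ^ n) \<longlonglongrightarrow> ln a"
proof -
  have "((\<lambda>t. a powr t) has_real_derivative ln a) (at 0)"
    using assms by (auto intro!: derivative_eq_intros)
  then have lim: "(\<lambda>h. (a powr h - 1) / h) \<midarrow>0\<rightarrow> ln a"
    using assms by (simp add: DERIV_def)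
  have "filterlim (\<lambda>n. (1/2) ^ n :: real) (at 0) sequentially"
    by (auto simp: filterlim_at intro!: LIMSEQ_realpow_zero)
  from filterlim_compose[OF lim this] show ?thesis by simp
qed

section \<open>First-order variations and their traces\<close>

text \<open>The variations H_i and K_j are given in this form, with coefficients of any sign,
  because their traces against an inverse are then combinations of its values as a quadratic form.
  These are the data of the moment problem.\<close>

definition rank_one_sum :: "'r set \<Rightarrow> ('r \<Rightarrow> real) \<Rightarrow> ('r \<Rightarrow> 'a::euclidean_space) \<Rightarrow> 'a \<Rightarrow> 'a" where
  "rank_one_sum A \<sigma> v x = (\<Sum>r\<in>A. (\<sigma> r * inner (v r) x) *\<^sub>R v r)"

lemma inner_rank_one_sum: "inner (rank_one_sum A \<sigma> v x) y = (\<Sum>r\<in>A. \<sigma> r * inner (v r) x * inner (v r) y)"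
  by (simp add: rank_one_sum_def inner_sum_left)

lemma selfadjoint_rank_one_sum:
  assumes S: "subspace S" and v: "\<And>r. r \<in> A \<Longrightarrow> v r \<in> S"
  shows "rank_one_sum A \<sigma> v \<in> selfadjoint_ops S"
proof -
  have "linear (rank_one_sum A \<sigma> v)" unfolding rank_one_sum_def
    by (intro linear_compose_sum ballI linearI) (auto simp: inner_add_right algebra_simps)
  moreover have "rank_one_sum A \<sigma> v x \<in> S" for x
    unfolding rank_one_sum_def using S v by (intro subspace_sum subspace_scale)
  moreover have "inner (rank_one_sum A \<sigma> v x) y = inner (rank_one_sum A \<sigma> v y) x" for x y
    by (simp add: inner_rank_one_sum mult_ac)
  ultimately show ?thesis
    by (auto simp: selfadjoint_ops_def linear_on_subspace_def linear_add linear_scale inner_commute)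
qed

text \<open>Both sides are the trace of V^{-1} H, the derivative of log det at V in the direction H:
  on the left as the sum of relative eigenvalues, on the right using that V^{-1} is the unit-weight
  operator of the family e.\<close>

lemma sum_coefficients_rank_one_sum:
  assumes S: "subspace S" and v: "\<And>r. r \<in> A \<Longrightarrow> v r \<in> S"
    and ef: "dual_frame S e f"
    and V: "\<And>x. x \<in> S \<Longrightarrow> V x = frame_op S f (\<lambda>_. 1) x"
    and H: "\<And>x. x \<in> S \<Longrightarrow> rank_one_sum A \<sigma> v x = frame_op S f \<eta> x"
  shows "(\<Sum>l<dim S. \<eta> l) = (\<Sum>r\<in>A. \<sigma> r * inner (inv_into S V (v r)) (v r))"
proof -
  have "(\<Sum>l<dim S. \<eta> l) = (\<Sum>l<dim S. \<Sum>r\<in>A. \<sigma> r * inner (v r) (e l) * inner (v r) (e l))"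
    using frame_op_coefficient[OF S ef H] by (intro sum.cong) (auto simp: inner_rank_one_sum)
  also have "\<dots> = (\<Sum>r\<in>A. \<sigma> r * inner (frame_op S e (\<lambda>_. 1) (v r)) (v r))"
    by (subst sum.swap) (simp add: inner_frame_op sum_distrib_left mult_ac)
  also have "\<dots> = (\<Sum>r\<in>A. \<sigma> r * inner (inv_into S V (v r)) (v r))"
    using bij_betw_frame_op(2)[OF S ef V] v by (intro sum.cong) auto
  finally show ?thesis .
qed

lemma frame_op_affine:
  "frame_op S f (\<lambda>l. 1 + t * \<eta> l) x = frame_op S f (\<lambda>_. 1) x + t *\<^sub>R frame_op S f \<eta> x"
  by (simp add: frame_op_def scaleR_sum_right sum.distrib[symmetric] algebra_simps)

lemma frame_op_const: "frame_op S f (\<lambda>_. s) x = s *\<^sub>R frame_op S f (\<lambda>_. 1) x"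
  by (simp add: frame_op_def scaleR_sum_right)

lemma ln_difference_quotient_tendsto:
  "((\<lambda>t. ln (1 + t * a) / t) \<longlongrightarrow> (a::real)) (at_right 0)"
proof -
  have "((\<lambda>t. ln (1 + t * a)) has_real_derivative a) (at 0)"
    by (auto intro!: derivative_eq_intros)
  then have "((\<lambda>t. ln (1 + t * a) / t) \<longlongrightarrow> a) (at 0)"
    by (simp add: DERIV_def)
  then show ?thesis by (rule tendsto_mono[OF at_le, rotated]) simp
qed

text \<open>Polarization: l = m fixes the diagonal entries, after which the sums e_l + e_m fix the
  mixed ones. Finitely many scalar conditions thus determine a symmetric form, which is how operator
  identities enter the moment problem.\<close>

lemma symmetric_forms_agree:
  fixes a b :: "'a::euclidean_space \<Rightarrow> 'a \<Rightarrow> real"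
  assumes a: "bilinear a" and b: "bilinear b"
    and asym: "\<And>x y. a x y = a y x" and bsym: "\<And>x y. b x y = b y x"
    and e: "dual_frame S e e"
    and eq: "\<And>l m. l < dim S \<Longrightarrow> m < dim S \<Longrightarrow> a (e l + e m) (e l + e m) = b (e l + e m) (e l + e m)"
    and x: "x \<in> S" "y \<in> S"
  shows "a x y = b x y"
proof -
  have exp: "h (e l + e m) (e l + e m) = h (e l) (e l) + 2 * h (e l) (e m) + h (e m) (e m)"
    if "bilinear h" "\<And>x y. h x y = h y x" for h :: "'a \<Rightarrow> 'a \<Rightarrow> real" and l m
    using that(2)[of "e m" "e l"] by (simp add: bilinear_ladd[OF that(1)] bilinear_radd[OF that(1)])
  have diag: "a (e l) (e l) = b (e l) (e l)" if "l < dim S" for l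
    using eq[OF that that] exp[OF a asym] exp[OF b bsym] by simp
  have off: "a (e l) (e m) = b (e l) (e m)" if "l < dim S" "m < dim S" for l m
    using eq[OF that] exp[OF a asym] exp[OF b bsym] diag that by simp
  have S: "S \<subseteq> span (e ` {..<dim S})"
  proof
    fix z assume "z \<in> S"
    then have "z = (\<Sum>l<dim S. inner z (e l) *\<^sub>R e l)" using e unfolding dual_frame_def by blast
    also have "\<dots> \<in> span (e ` {..<dim S})"
      by (intro span_sum span_scale span_base) auto
    finally show "z \<in> span (e ` {..<dim S})" .
  qed
  show ?thesis using off by (intro bilinear_eq[OF a b S S x]) auto
qed

lemma inv_into_posdef_inverse:
  assumes S: "subspace S" and A: "A \<in> posdef_ops S" and G: "\<And>x. x \<in> S \<Longrightarrow> G x = inv_into S A x"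
  shows "bij_betw G S S" and "\<And>x. x \<in> S \<Longrightarrow> inv_into S G x = A x"
proof -
  have bA: "bij_betw A S S" by (rule posdef_inverse[OF S A])
  then show bG: "bij_betw G S S"
    using bij_betw_inv_into[OF bA] G by (simp add: bij_betw_cong[of S G "inv_into S A"])
  show "inv_into S G x = A x" if "x \<in> S" for x
    using bA bG that G[of "A x"] by (intro inv_into_f_eq) (auto simp: bij_betw_def)
qed

lemma orthonormal_frame_exists:
  assumes "subspace S" shows "\<exists>b. dual_frame S b b"
  using orthonormal_basis_exists[OF assms] orthonormal_basis_dual_frame(2) by blast

lemma dual_frame_norm:
  assumes "subspace S" "dual_frame S b b"
  shows "inner (orth_proj S z) (orth_proj S z) = (\<Sum>l<dim S. (inner (b l) z)\<^sup>2)"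
proof -
  have bS: "b l \<in> S" if "l < dim S" for l using assms(2) that by (simp add: dual_frame_def)
  have "inner (orth_proj S z) (orth_proj S z) = inner (orth_proj S z) z"
    by (metis assms(1) inner_orth_proj orth_proj_in inner_commute)
  also have "\<dots> = inner (\<Sum>l<dim S. inner (orth_proj S z) (b l) *\<^sub>R b l) z"
    using assms orth_proj_in unfolding dual_frame_def by metis
  also have "\<dots> = (\<Sum>l<dim S. (inner (b l) z)\<^sup>2)" unfolding inner_sum_left
    using bS by (intro sum.cong)
      (auto simp: inner_orth_proj[OF assms(1)] power2_eq_square inner_commute[of "b _" z])
  finally show ?thesis .
qed

subsection \<open>Stationary points are extremizers\<close>

locale gaussian_datum =
  fixes E :: "'k::finite \<Rightarrow> 'a::euclidean_space set"
    and F :: "'m::finite \<Rightarrow> 'b::euclidean_space set"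
    and B :: "'k \<Rightarrow> 'm \<Rightarrow> 'a \<Rightarrow> 'b"
    and c :: "'k \<Rightarrow> real"
    and d :: "'m \<Rightarrow> real"
  assumes orthogonal_E: "orthogonal_subspaces E"
    and subspace_F: "\<And>j. subspace (F j)"
    and linear_B: "\<And>i j. linear_on_subspace (E i) (F j) (B i j)"
    and c_pos: "\<And>i. 0 < c i"
    and d_pos: "\<And>j. 0 < d j"
begin

abbreviation E0 :: "'a set" where "E0 \<equiv> total_space E"

text \<open>In the constraint and in the covariance, B_j occurs only multiplied by Lambda_c, so the
  product is handled as one operator; \<open>L_adj\<close> is its adjoint.\<close>

definition L :: "'m \<Rightarrow> 'a \<Rightarrow> 'b" where "L j x = B_total E B j (Lam E c x)"

definition L_adj :: "'m \<Rightarrow> 'b \<Rightarrow> 'a" where "L_adj j y = Lam E c (B_adj E B j y)"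

lemma subspace_E: "subspace (E i)"
  and inner_E: "i \<noteq> i' \<Longrightarrow> x \<in> E i \<Longrightarrow> y \<in> E i' \<Longrightarrow> inner x y = 0"
  using orthogonal_E by (auto simp: orthogonal_subspaces_def)

lemma subspace_E0: "subspace E0"
  by (simp add: total_space_def)

lemma E_subset: "x \<in> E i \<Longrightarrow> x \<in> E0"
  unfolding total_space_def by (auto intro: span_base)

lemma orth_proj_E_E: "x \<in> E i \<Longrightarrow> orth_proj (E i') x = (if i' = i then x else 0)"
  using subspace_E inner_E[of i i' x] by (auto simp: orth_proj_id intro!: orth_proj_zero)

lemma orth_proj_E_E0: "orth_proj (E i) (orth_proj E0 x) = orth_proj (E i) x"
  using orth_proj_in[OF subspace_E] E_subset
  by (intro orth_proj_eqI subspace_E) (auto simp: inner_diff_left inner_orth_proj subspace_E subspace_E0)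

lemma E0_decomposition:
  assumes "x \<in> E0" shows "x = (\<Sum>i\<in>UNIV. orth_proj (E i) x)"
proof -
  have "E0 \<subseteq> {x. x = (\<Sum>i\<in>UNIV. orth_proj (E i) x)}" unfolding total_space_def
  proof (rule span_minimal)
    show "(\<Union>i. E i) \<subseteq> {x. x = (\<Sum>i\<in>UNIV. orth_proj (E i) x)}"
      by (auto simp: orth_proj_E_E)
    have lin: "linear (\<lambda>x. \<Sum>i\<in>UNIV. orth_proj (E i) x)"
      by (intro linear_compose_sum ballI linear_orth_proj subspace_E)
    show "subspace {x. x = (\<Sum>i\<in>UNIV. orth_proj (E i) x)}"
      using linear_0[OF lin] linear_add[OF lin] linear_scale[OF lin] by (intro subspaceI) auto
  qed
  then show ?thesis using assms by blast
qed

lemma linear_sum_op: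
  assumes "\<And>i. linear_on_subspace (E i) (T i) (W i)"
  shows "linear (sum_op E W)"
  unfolding sum_op_def using assms
  by (intro linear_compose_sum ballI linear_on_subspace_ext[OF subspace_E])

lemma linear_B_total: "linear (B_total E B j)"
  unfolding B_total_def by (rule linear_sum_op[where T = "\<lambda>_. F j"]) (rule linear_B)

lemma B_total_in: "B_total E B j x \<in> F j"
  unfolding B_total_def sum_op_def using linear_B orth_proj_in[OF subspace_E]
  by (intro subspace_sum subspace_F) (auto simp: linear_on_subspace_def)

lemma Lam_eq: "Lam E c x = (\<Sum>i\<in>UNIV. c i *\<^sub>R orth_proj (E i) x)"
  by (simp add: Lam_def sum_op_def)

lemma linear_Lam: "linear (Lam E c)"
  unfolding Lam_def
  by (rule linear_sum_op[where T = E])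
    (auto simp: linear_on_subspace_def subspace_E subspace_scale algebra_simps)

lemma Lam_in: "Lam E c x \<in> E0"
  unfolding Lam_eq using orth_proj_in[OF subspace_E] E_subset
  by (intro subspace_sum subspace_scale subspace_E0) auto

lemma Lam_selfadjoint: "inner (Lam E c x) y = inner x (Lam E c y)"
  by (simp add: Lam_eq inner_sum_left inner_sum_right orth_proj_selfadjoint[OF subspace_E])

text \<open>The witness is the projection to E0 of the adjoint on the ambient space. Since
  \<open>B_total\<close> ignores the component orthogonal to E0, the adjoint identity holds for all
  z of the ambient space.\<close>

lemma B_adj: "B_adj E B j y \<in> E0 \<and> (\<forall>z. inner (B_total E B j z) y = inner z (B_adj E B j y))"
proof -
  let ?x = "orth_proj E0 (adjoint (B_total E B j) y)"
  have *: "inner (B_total E B j z) y = inner z ?x" for z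
  proof -
    have "B_total E B j z = B_total E B j (orth_proj E0 z)"
      by (simp add: B_total_def sum_op_def orth_proj_E_E0)
    then show ?thesis
      by (metis adjoint_works[OF linear_B_total] orth_proj_selfadjoint[OF subspace_E0])
  qed
  have "B_adj E B j y = ?x" unfolding B_adj_def adjoint_on_def
  proof (rule the_equality)
    show "?x \<in> E0 \<and> (\<forall>z\<in>E0. inner (B_total E B j z) y = inner z ?x)"
      using * orth_proj_in[OF subspace_E0] by blast
    show "x = ?x" if "x \<in> E0 \<and> (\<forall>z\<in>E0. inner (B_total E B j z) y = inner z x)" for x
      using that * orth_proj_in[OF subspace_E0]
      by (intro subspace_eqI[OF subspace_E0]) (auto simp: inner_commute)
  qed
  then show ?thesis using * orth_proj_in[OF subspace_E0] by simp
qed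

lemma linear_L: "linear (L j)"
  unfolding L_def using linear_compose[OF linear_Lam linear_B_total] by (simp add: o_def)

lemma L_in: "L j x \<in> F j"
  by (simp add: L_def B_total_in)

lemma inner_L: "inner (L j x) y = inner x (L_adj j y)"
  using B_adj by (simp add: L_def L_adj_def Lam_selfadjoint)

lemma L_adj_in: "L_adj j y \<in> E0"
  by (simp add: L_adj_def Lam_in)

lemma linear_L_adj: "linear (L_adj j)"
proof -
  have "adjoint (L j) = L_adj j" by (rule adjoint_unique) (simp add: inner_L)
  then show ?thesis using adjoint_linear[OF linear_L] by metis
qed

lemma U_form_eq: "U_form E c d B U x = (\<Sum>j\<in>UNIV. d j *\<^sub>R L_adj j (U j (L j x)))"
  by (simp add: U_form_def L_def L_adj_def)

lemma B_cov_eq: "B_cov E c B P j y = L j (P (L_adj j y))"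
  by (simp add: B_cov_def L_def L_adj_def)

lemma inner_U_form: "inner (U_form E c d B U x) y = (\<Sum>j\<in>UNIV. d j * inner (U j (L j x)) (L j y))"
  by (simp add: U_form_eq inner_sum_left) (simp add: inner_commute[of "L_adj _ _"] inner_L[symmetric] inner_commute)

lemma inner_weighted_sum_op:
  assumes "\<And>i. V i \<in> selfadjoint_ops (E i)"
  shows "inner (weighted_sum_op E c V x) y =
    (\<Sum>i\<in>UNIV. c i * inner (V i (orth_proj (E i) x)) (orth_proj (E i) y))"
proof -
  have "inner (V i (orth_proj (E i) x)) (orth_proj (E i) y) = inner (V i (orth_proj (E i) x)) y" for i
    using selfadjoint_ops_in[OF assms orth_proj_in[OF subspace_E]] subspace_E
    by (metis inner_commute inner_orth_proj)
  then show ?thesis by (simp add: weighted_sum_op_def sum_op_def inner_sum_left)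
qed

text \<open>The order relation also demands that the difference be a selfadjoint operator of E0.
  That is automatic here, so only the inequality of quadratic forms remains.\<close>

lemma loewner_le_iff:
  assumes V: "\<And>i. V i \<in> selfadjoint_ops (E i)" and U: "\<And>j. U j \<in> selfadjoint_ops (F j)"
  shows "loewner_le E0 (U_form E c d B U) (weighted_sum_op E c V) \<longleftrightarrow>
    (\<forall>x\<in>E0. (\<Sum>j\<in>UNIV. d j * inner (U j (L j x)) (L j x))
      \<le> (\<Sum>i\<in>UNIV. c i * inner (V i (orth_proj (E i) x)) (orth_proj (E i) x)))"
proof -
  have lU: "linear_on_subspace (F j) (F j) (U j)" for j using U by (simp add: selfadjoint_ops_def)
  have lV: "linear_on_subspace (E i) (E i) (\<lambda>x. c i *\<^sub>R V i x)" for i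
    using V subspace_E
    by (auto simp: selfadjoint_ops_def linear_on_subspace_def subspace_scale scaleR_add_right)
  have VE: "V i (orth_proj (E i) x) \<in> E i" for i x
    by (rule selfadjoint_ops_in[OF V orth_proj_in[OF subspace_E]])
  let ?g = "\<lambda>x. weighted_sum_op E c V x - U_form E c d B U x"
  have "linear (\<lambda>x. U j (L j x))" for j
    using lU L_in by (intro linearI) (auto simp: linear_on_subspace_def linear_add[OF linear_L] linear_scale[OF linear_L])
  then have "linear (\<lambda>x. d j *\<^sub>R L_adj j (U j (L j x)))" for j
    using linear_compose[of "\<lambda>x. U j (L j x)" "L_adj j"] linear_L_adj
    by (intro linear_compose_scale_right) (auto simp: o_def)
  then have "linear (U_form E c d B U)"
    unfolding U_form_eq[abs_def] by (intro linear_compose_sum) auto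
  moreover have "linear (weighted_sum_op E c V)"
  proof -
    have "linear (\<lambda>x. c i *\<^sub>R V i (orth_proj (E i) x))" for i by (rule linear_on_subspace_ext[OF subspace_E lV])
    then show ?thesis unfolding weighted_sum_op_def sum_op_def by (intro linear_compose_sum) auto
  qed
  ultimately have lin: "linear ?g" by (rule linear_compose_sub[rotated])
  have "?g x \<in> E0" for x
    unfolding U_form_eq weighted_sum_op_def sum_op_def using VE E_subset L_adj_in
    by (intro subspace_diff subspace_sum subspace_scale subspace_E0) auto
  moreover have "inner (?g x) y = inner x (?g y)" for x y
  proof -
    have "inner (U j (L j x)) (L j y) = inner (U j (L j y)) (L j x)" for j
      using U L_in by (auto simp: selfadjoint_ops_def inner_commute)
    moreover have "inner (V i (orth_proj (E i) x)) (orth_proj (E i) y) =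
        inner (V i (orth_proj (E i) y)) (orth_proj (E i) x)" for i
      using V orth_proj_in[OF subspace_E] by (auto simp: selfadjoint_ops_def inner_commute)
    ultimately have "inner (?g x) y = inner (?g y) x"
      by (simp add: inner_diff_left inner_U_form inner_weighted_sum_op[OF V])
    then show ?thesis by (simp add: inner_commute)
  qed
  ultimately have "?g \<in> selfadjoint_ops E0"
    using linear_add[OF lin] linear_scale[OF lin] by (auto simp: selfadjoint_ops_def linear_on_subspace_def)
  then show ?thesis
    by (simp add: loewner_le_def possemidef_ops_def inner_diff_left inner_U_form inner_weighted_sum_op[OF V])
qed

lemma gaussian_extremizer_iff:
  "gaussian_extremizer E F c d B V U \<longleftrightarrow> (V, U) \<in> gaussian_feasible E F c d B \<and>
    (\<forall>(V', U') \<in> gaussian_feasible E F c d B. gaussian_value E F c d V' U' \<le> gaussian_value E F c d V U)"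
proof -
  let ?A = "gaussian_feasible E F c d B"
  let ?g = "\<lambda>(V, U). ereal (gaussian_value E F c d V U)"
  have half: "ereal (1/2) * s = ereal (1/2 * v) \<longleftrightarrow> s = ereal v" for s v
    by (cases s) auto
  have "(SUP z\<in>?A. ?g z) = ?g (V, U) \<longleftrightarrow> (\<forall>z\<in>?A. ?g z \<le> ?g (V, U))" if "(V, U) \<in> ?A"
    using that by (metis (no_types, lifting) SUP_eqI SUP_upper)
  then show ?thesis
    unfolding gaussian_extremizer_def D_g_def half by (auto simp: case_prod_unfold)
qed

text \<open>An attained supremum equals a real number, so finiteness comes with the
  extremizer.\<close>

lemma gaussian_extremizable_iff:
  "gaussian_extremizable E F c d B \<longleftrightarrow> (\<exists>V U. gaussian_extremizer E F c d B V U)"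
  by (auto simp: gaussian_extremizable_def gaussian_extremizer_def)

lemma gaussian_feasible_iff:
  "(V, U) \<in> gaussian_feasible E F c d B \<longleftrightarrow>
    (\<forall>i. V i \<in> posdef_ops (E i)) \<and> (\<forall>j. U j \<in> posdef_ops (F j)) \<and>
    (\<forall>x\<in>E0. (\<Sum>j\<in>UNIV. d j * inner (U j (L j x)) (L j x))
      \<le> (\<Sum>i\<in>UNIV. c i * inner (V i (orth_proj (E i) x)) (orth_proj (E i) x)))"
  by (auto simp: gaussian_feasible_def loewner_le_iff posdef_imp_selfadjoint)

lemma B_cov_possemidef:
  assumes "P \<in> possemidef_ops E0"
  shows "B_cov E c B P j \<in> possemidef_ops (F j)"
proof -
  have P: "P x \<in> E0" "P (x + y) = P x + P y" "P (r *\<^sub>R x) = r *\<^sub>R P x" "inner (P x) y = inner x (P y)" "0 \<le> inner (P x) x"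
    if "x \<in> E0" "y \<in> E0" for x y r
    using assms that by (auto simp: possemidef_ops_def selfadjoint_ops_def linear_on_subspace_def)
  have "inner (B_cov E c B P j x) y = inner (P (L_adj j x)) (L_adj j y)" for x y
    by (simp add: B_cov_eq inner_L)
  moreover from this have "inner (B_cov E c B P j x) y = inner x (B_cov E c B P j y)" for x y
    using P(4)[OF L_adj_in L_adj_in] by (metis inner_commute)
  moreover have "B_cov E c B P j (x + y) = B_cov E c B P j x + B_cov E c B P j y"
    "B_cov E c B P j (r *\<^sub>R x) = r *\<^sub>R B_cov E c B P j x" for x y r
    using P(2,3)[OF L_adj_in L_adj_in]
    by (auto simp: B_cov_eq linear_add[OF linear_L] linear_scale[OF linear_L]
        linear_add[OF linear_L_adj] linear_scale[OF linear_L_adj])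
  ultimately show ?thesis
    using L_in P(5)[OF L_adj_in L_adj_in]
    by (simp add: possemidef_ops_def selfadjoint_ops_def linear_on_subspace_def) (simp add: B_cov_eq)
qed

lemma stationary_imp_extremizer:
  assumes dims: "(\<Sum>i\<in>UNIV. c i * real (dim (E i))) = (\<Sum>j\<in>UNIV. d j * real (dim (F j)))"
    and V: "\<And>i. V i \<in> posdef_ops (E i)"
    and P: "P \<in> couplings E (\<lambda>i. inv_into (E i) (V i))"
    and bij: "\<And>j. bij_betw (B_cov E c B P j) (F j) (F j)"
    and le: "loewner_le E0 (U_form E c d B (\<lambda>j. inv_into (F j) (B_cov E c B P j))) (weighted_sum_op E c V)"
  shows "gaussian_extremizer E F c d B V (\<lambda>j. inv_into (F j) (B_cov E c B P j))"
proof -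
  define Q where "Q j = B_cov E c B P j" for j
  define U where "U j = inv_into (F j) (Q j)" for j
  have Ppsd: "P \<in> possemidef_ops E0" using P by (simp add: couplings_def)
  have Q: "Q j \<in> posdef_ops (F j)" for j
    using possemidef_inj_imp_posdef[OF subspace_F B_cov_possemidef[OF Ppsd]] bij
    by (auto simp: Q_def bij_betw_def)
  have U: "U j \<in> posdef_ops (F j)" for j
    unfolding U_def by (rule posdef_inverse[OF subspace_F Q])
  have feasible: "(V, U) \<in> gaussian_feasible E F c d B"
    using V U le by (simp add: gaussian_feasible_def U_def[abs_def] Q_def)
  have "gaussian_value E F c d V' U' \<le> gaussian_value E F c d V U"
    if feasible': "(V', U') \<in> gaussian_feasible E F c d B" for V' U'
  proof -
    have V': "V' i \<in> posdef_ops (E i)" and U': "U' j \<in> posdef_ops (F j)" for i j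
      using feasible' by (auto simp: gaussian_feasible_def)
    \<comment> \<open>V is the reference point with all weights 1, and the weights
      \<open>\<mu>\<close> of V' are its eigenvalues relative to V. In the same frame the geodesic
      from V to V' has weights \<open>\<mu> i l powr t\<close>.\<close>
    obtain e f \<mu> where ef: "\<And>i. dual_frame (E i) (e i) (f i)"
      and Vf: "\<And>i x. x \<in> E i \<Longrightarrow> V i x = frame_op (E i) (f i) (\<lambda>_. 1) x"
      and V'f: "\<And>i x. x \<in> E i \<Longrightarrow> V' i x = frame_op (E i) (f i) (\<mu> i) x"
      by (rule diagonalize_family[OF V posdef_imp_selfadjoint[OF V'] subspace_E]) (rule that)
    obtain g h \<nu> where gh: "\<And>j. dual_frame (F j) (g j) (h j)"
      and Uh: "\<And>j x. x \<in> F j \<Longrightarrow> U j x = frame_op (F j) (h j) (\<lambda>_. 1) x"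
      and U'h: "\<And>j x. x \<in> F j \<Longrightarrow> U' j x = frame_op (F j) (h j) (\<nu> j) x"
      by (rule diagonalize_family[OF U posdef_imp_selfadjoint[OF U'] subspace_F]) (rule that)
    have \<mu>: "0 < \<mu> i l" if "l < dim (E i)" for i l
      by (rule frame_op_coefficient_pos[OF subspace_E ef V' V'f that])
    have \<nu>: "0 < \<nu> j l" if "l < dim (F j)" for j l
      by (rule frame_op_coefficient_pos[OF subspace_F gh U' U'h that])
    define I where "I = (SIGMA i:UNIV. {..<dim (E i)})"
    define J where "J = (SIGMA j:UNIV. {..<dim (F j)})"
    have finI: "finite I" and finJ: "finite J" by (auto simp: I_def J_def)
    have sumI: "(\<Sum>i\<in>UNIV. c i * (\<Sum>l<dim (E i). \<phi> i l)) = (\<Sum>(i, l)\<in>I. c i * \<phi> i l)" for \<phi>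
      by (simp add: I_def sum_distrib_left sum.Sigma)
    have sumJ: "(\<Sum>j\<in>UNIV. d j * (\<Sum>l<dim (F j). \<phi> j l)) = (\<Sum>(j, l)\<in>J. d j * \<phi> j l)" for \<phi>
      by (simp add: J_def sum_distrib_left sum.Sigma)
    \<comment> \<open>The coordinate functional of \<open>h j l\<close> pulled back by L_j. Both
      sides of the constraint become weighted sums of squares of linear forms in x.\<close>
    define k where "k j l = L_adj j (h j l)" for j l
    have fE: "f i l \<in> E i" "e i l \<in> E i" if "l < dim (E i)" for i l
      using ef that by (auto simp: dual_frame_def)
    have hF: "h j l \<in> F j" if "l < dim (F j)" for j l
      using gh that by (auto simp: dual_frame_def)
    have V_form: "(\<Sum>i\<in>UNIV. c i * inner (frame_op (E i) (f i) (w i) (orth_proj (E i) x)) (orth_proj (E i) x))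
        = (\<Sum>(i, l)\<in>I. c i * (w i l * (inner x (f i l))\<^sup>2))" for w x
    proof -
      have "inner (frame_op (E i) (f i) (w i) (orth_proj (E i) x)) (orth_proj (E i) x) =
          (\<Sum>l<dim (E i). w i l * (inner x (f i l))\<^sup>2)" for i
        unfolding inner_frame_op using fE
        by (intro sum.cong) (auto simp: inner_orth_proj[OF subspace_E] power2_eq_square)
      then show ?thesis by (simp only: sumI)
    qed
    have U_form: "(\<Sum>j\<in>UNIV. d j * inner (frame_op (F j) (h j) (w j) (L j x)) (L j x))
        = (\<Sum>(j, l)\<in>J. d j * (w j l * (inner x (k j l))\<^sup>2))" for w x
    proof -
      have "inner (frame_op (F j) (h j) (w j) (L j x)) (L j x) =
          (\<Sum>l<dim (F j). w j l * (inner x (k j l))\<^sup>2)" for j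
        unfolding inner_frame_op by (intro sum.cong) (auto simp: inner_L k_def power2_eq_square)
      then show ?thesis by (simp only: sumJ)
    qed
    have le0: "(\<Sum>(j, l)\<in>J. d j * (inner x (k j l))\<^sup>2) \<le> (\<Sum>(i, l)\<in>I. c i * (inner x (f i l))\<^sup>2)"
      if "x \<in> E0" for x
      using feasible that U_form[of "\<lambda>_ _. 1" x] V_form[of "\<lambda>_ _. 1" x]
      by (auto simp: gaussian_feasible_iff Vf Uh L_in orth_proj_in[OF subspace_E])
    have le1: "(\<Sum>(j, l)\<in>J. d j * (\<nu> j l * (inner x (k j l))\<^sup>2)) \<le> (\<Sum>(i, l)\<in>I. c i * (\<mu> i l * (inner x (f i l))\<^sup>2))"
      if "x \<in> E0" for x
      using feasible' that U_form[of \<nu> x] V_form[of \<mu> x]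
      by (auto simp: gaussian_feasible_iff V'f U'h L_in orth_proj_in[OF subspace_E])
    \<comment> \<open>Each induction step halves the exponent: it is the geometric mean of the
      inequality at exponent 2^-n with \<open>le0\<close>, the inequality at exponent 0.\<close>
    have le_pow: "(\<Sum>(j, l)\<in>J. d j * (\<nu> j l powr ((1/2) ^ n) * (inner x (k j l))\<^sup>2))
        \<le> (\<Sum>(i, l)\<in>I. c i * (\<mu> i l powr ((1/2) ^ n) * (inner x (f i l))\<^sup>2))" if "x \<in> E0" for x n
      using that
    proof (induction n arbitrary: x)
      case 0
      have "(\<Sum>(j, l)\<in>J. d j * (\<nu> j l powr 1 * (inner x (k j l))\<^sup>2)) = (\<Sum>(j, l)\<in>J. d j * (\<nu> j l * (inner x (k j l))\<^sup>2))"
        using \<nu> by (intro sum.cong) (auto simp: J_def less_imp_le)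
      moreover have "(\<Sum>(i, l)\<in>I. c i * (\<mu> i l powr 1 * (inner x (f i l))\<^sup>2)) = (\<Sum>(i, l)\<in>I. c i * (\<mu> i l * (inner x (f i l))\<^sup>2))"
        using \<mu> by (intro sum.cong) (auto simp: I_def less_imp_le)
      ultimately show ?case using le1[OF 0] by simp
    next
      case (Suc n)
      have sq: "(a powr ((1/2) ^ Suc n))\<^sup>2 = a powr ((1/2) ^ n)" if "0 < a" for a :: real
        using that by (simp add: power2_eq_square powr_add[symmetric])
      have "(\<Sum>r\<in>J. d (fst r) * (\<nu> (fst r) (snd r) powr ((1/2) ^ Suc n)) * (inner x (k (fst r) (snd r)))\<^sup>2)
          \<le> (\<Sum>s\<in>I. c (fst s) * (\<mu> (fst s) (snd s) powr ((1/2) ^ Suc n)) * (inner x (f (fst s) (snd s)))\<^sup>2)"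
      proof (rule geometric_mean_form_le[OF finI finJ subspace_E0,
            where e = "\<lambda>s. e (fst s) (snd s)" and x = x])
        show "e (fst s) (snd s) \<in> E0" if "s \<in> I" for s
          using that E_subset[OF fE(2)] by (auto simp: I_def)
        show "inner (e (fst s) (snd s)) (f (fst t) (snd t)) = (if s = t then 1 else 0)"
          if "s \<in> I" "t \<in> I" for s t
          using that ef inner_E fE by (cases "fst s = fst t") (auto simp: I_def dual_frame_def prod_eq_iff)
        show "y = 0" if y: "y \<in> E0" and 0: "\<And>s. s \<in> I \<Longrightarrow> inner y (f (fst s) (snd s)) = 0" for y
        proof -
          have "orth_proj (E i) y = 0" for i
          proof -
            have "orth_proj (E i) y = (\<Sum>l<dim (E i). inner (orth_proj (E i) y) (f i l) *\<^sub>R e i l)"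
              using ef orth_proj_in[OF subspace_E] unfolding dual_frame_def by blast
            also have "\<dots> = 0"
              using 0[of "(i, _)"] fE by (intro sum.neutral) (auto simp: inner_orth_proj[OF subspace_E] I_def)
            finally show ?thesis .
          qed
          then show ?thesis using E0_decomposition[OF y] by simp
        qed
        show "(\<Sum>r\<in>J. d (fst r) * (inner y (k (fst r) (snd r)))\<^sup>2)
            \<le> (\<Sum>s\<in>I. c (fst s) * (inner y (f (fst s) (snd s)))\<^sup>2)" if "y \<in> E0" for y
          using le0[OF that] by (simp add: case_prod_unfold)
        show "(\<Sum>r\<in>J. d (fst r) * (\<nu> (fst r) (snd r) powr ((1/2) ^ Suc n))\<^sup>2 * (inner y (k (fst r) (snd r)))\<^sup>2)
            \<le> (\<Sum>s\<in>I. c (fst s) * (\<mu> (fst s) (snd s) powr ((1/2) ^ Suc n))\<^sup>2 * (inner y (f (fst s) (snd s)))\<^sup>2)"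
          if y: "y \<in> E0" for y
        proof -
          have "(\<Sum>r\<in>J. d (fst r) * (\<nu> (fst r) (snd r) powr ((1/2) ^ Suc n))\<^sup>2 * (inner y (k (fst r) (snd r)))\<^sup>2)
              = (\<Sum>(j, l)\<in>J. d j * (\<nu> j l powr ((1/2) ^ n) * (inner y (k j l))\<^sup>2))"
            using \<nu> sq by (intro sum.cong) (auto simp: J_def mult.assoc simp del: power_Suc)
          moreover have "(\<Sum>s\<in>I. c (fst s) * (\<mu> (fst s) (snd s) powr ((1/2) ^ Suc n))\<^sup>2 * (inner y (f (fst s) (snd s)))\<^sup>2)
              = (\<Sum>(i, l)\<in>I. c i * (\<mu> i l powr ((1/2) ^ n) * (inner y (f i l))\<^sup>2))"
            using \<mu> sq by (intro sum.cong) (auto simp: I_def mult.assoc simp del: power_Suc)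
          ultimately show ?thesis using Suc.IH[OF y] by simp
        qed
      qed (use c_pos d_pos Suc.prems in auto)
      then show ?case by (simp add: case_prod_unfold mult.assoc del: power_Suc)
    qed
    \<comment> \<open>Pairing a quadratic form with P means summing its values at the vectors b_m
      with the nonnegative weights \<open>\<beta> m\<close>. This turns an inequality of forms on E0
      into one of numbers.\<close>
    obtain b \<beta> where b: "dual_frame E0 b b" and \<beta>: "\<And>m. m < dim E0 \<Longrightarrow> 0 \<le> \<beta> m"
      and Pb: "\<And>x. x \<in> E0 \<Longrightarrow> P x = frame_op E0 b \<beta> x"
      using psd_spectral[OF subspace_E0 Ppsd] by metis
    have tr: "(\<Sum>m<dim E0. \<beta> m * (inner (b m) x)\<^sup>2) = inner (P x) x" if "x \<in> E0" for x
      using that by (simp add: Pb inner_frame_op power2_eq_square inner_commute[of "b _"] mult.assoc)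
    \<comment> \<open>P has diagonal block V_i^{-1}, which sends f_l to e_l, and these are
      dual.\<close>
    have trI: "(\<Sum>m<dim E0. \<beta> m * (inner (b m) (f i l))\<^sup>2) = 1" if l: "l < dim (E i)" for i l
    proof -
      have "inner (P (f i l)) (f i l) = inner (inv_into (E i) (V i) (f i l)) (f i l)"
        using P fE[OF l] by (auto simp: couplings_def)
      also have "inv_into (E i) (V i) (f i l) = e i l"
        using bij_betw_frame_op(2)[OF subspace_E ef Vf] fE[OF l]
          frame_op_dual[OF subspace_E dual_frame_sym[OF subspace_E ef] l] by simp
      finally show ?thesis using tr[OF E_subset[OF fE(1)[OF l]]] ef l by (simp add: dual_frame_def)
    qed
    \<comment> \<open>The same on the other side: L_j P L_j^* is the inverse of U_j and sends h_l to
      g_l.\<close>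
    have trJ: "(\<Sum>m<dim E0. \<beta> m * (inner (b m) (k j l))\<^sup>2) = 1" if l: "l < dim (F j)" for j l
    proof -
      have gF: "g j l \<in> F j" using gh l by (simp add: dual_frame_def)
      have "h j l = U j (g j l)"
        using Uh[OF gF] frame_op_dual[OF subspace_F gh l] by simp
      then have "Q j (h j l) = g j l"
        unfolding U_def using gF posdef_inverse(1)[OF subspace_F Q]
        by (simp add: f_inv_into_f bij_betw_def)
      then have "inner (P (k j l)) (k j l) = 1"
        using gh l by (simp add: Q_def B_cov_eq k_def[symmetric] inner_L dual_frame_def)
          (metis inner_L B_cov_eq k_def)
      then show ?thesis using tr L_adj_in by (simp add: k_def)
    qed
    have trace_le: "(\<Sum>(j, l)\<in>J. d j * \<nu> j l powr ((1/2) ^ n)) \<le> (\<Sum>(i, l)\<in>I. c i * \<mu> i l powr ((1/2) ^ n))" for n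
    proof -
      let ?\<nu> = "\<lambda>j l. \<nu> j l powr ((1/2) ^ n)" and ?\<mu> = "\<lambda>i l. \<mu> i l powr ((1/2) ^ n)"
      have "(\<Sum>(j, l)\<in>J. d j * ?\<nu> j l) = (\<Sum>(j, l)\<in>J. d j * ?\<nu> j l * (\<Sum>m<dim E0. \<beta> m * (inner (b m) (k j l))\<^sup>2))"
        using trJ by (intro sum.cong) (auto simp: J_def)
      also have "\<dots> = (\<Sum>m<dim E0. \<beta> m * (\<Sum>(j, l)\<in>J. d j * (?\<nu> j l * (inner (b m) (k j l))\<^sup>2)))"
        by (simp add: case_prod_unfold sum_distrib_left sum.swap[of _ _ J] mult_ac)
      also have "\<dots> \<le> (\<Sum>m<dim E0. \<beta> m * (\<Sum>(i, l)\<in>I. c i * (?\<mu> i l * (inner (b m) (f i l))\<^sup>2)))"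
        using \<beta> le_pow b by (intro sum_mono mult_left_mono) (auto simp: dual_frame_def)
      also have "\<dots> = (\<Sum>(i, l)\<in>I. c i * ?\<mu> i l * (\<Sum>m<dim E0. \<beta> m * (inner (b m) (f i l))\<^sup>2))"
        by (simp add: case_prod_unfold sum_distrib_left sum.swap[of _ _ I] mult_ac)
      also have "\<dots> = (\<Sum>(i, l)\<in>I. c i * ?\<mu> i l)"
        using trI by (intro sum.cong) (auto simp: I_def)
      finally show ?thesis .
    qed
    have dimIJ: "(\<Sum>(i, l)\<in>I. c i) = (\<Sum>(j, l)\<in>J. d j)"
      using dims sumI[of "\<lambda>_ _. 1"] sumJ[of "\<lambda>_ _. 1"] by simp
    \<comment> \<open>On the left, ln x <= x - 1 at x = \<open>\<nu> j l powr t\<close> already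
      produces the logarithm for each t. On the right the difference quotient is kept and produces
      it in the limit. Subtracting 1 from all powers is allowed because of
      \<open>dimIJ\<close>.\<close>
    have bound: "(\<Sum>(j, l)\<in>J. d j * ln (\<nu> j l)) \<le> (\<Sum>(i, l)\<in>I. c i * ((\<mu> i l powr ((1/2) ^ n) - 1) / (1/2) ^ n))" for n
    proof -
      define t :: real where "t = (1/2) ^ n"
      have t: "0 < t" by (simp add: t_def)
      have "t * (\<Sum>(j, l)\<in>J. d j * ln (\<nu> j l)) \<le> (\<Sum>(j, l)\<in>J. d j * (\<nu> j l powr t - 1))"
        unfolding sum_distrib_left
      proof (rule sum_mono, clarify)
        fix j l assume "(j, l) \<in> J"
        then have "0 < \<nu> j l" using \<nu> by (simp add: J_def)
        then have "t * ln (\<nu> j l) \<le> \<nu> j l powr t - 1"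
          using ln_le_minus_one[of "\<nu> j l powr t"] by (simp add: ln_powr)
        then show "t * (d j * ln (\<nu> j l)) \<le> d j * (\<nu> j l powr t - 1)"
          using d_pos[of j] by (simp add: mult.left_commute)
      qed
      also have "\<dots> \<le> (\<Sum>(i, l)\<in>I. c i * (\<mu> i l powr t - 1))"
        using trace_le[of n] dimIJ
        by (simp add: t_def[symmetric] case_prod_unfold right_diff_distrib sum_subtractf)
      also have "\<dots> = t * (\<Sum>(i, l)\<in>I. c i * ((\<mu> i l powr t - 1) / t))"
        using t by (simp add: sum_distrib_left case_prod_unfold)
      finally show ?thesis using t by (simp add: t_def[symmetric])
    qed
    have "(\<lambda>n. \<Sum>(i, l)\<in>I. c i * ((\<mu> i l powr ((1/2) ^ n) - 1) / (1/2) ^ n))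
        \<longlonglongrightarrow> (\<Sum>(i, l)\<in>I. c i * ln (\<mu> i l))"
      unfolding case_prod_unfold using \<mu>
      by (intro tendsto_sum tendsto_mult tendsto_const powr_difference_quotient_tendsto_ln) (auto simp: I_def)
    then have "(\<Sum>(j, l)\<in>J. d j * ln (\<nu> j l)) \<le> (\<Sum>(i, l)\<in>I. c i * ln (\<mu> i l))"
      using bound by (intro LIMSEQ_le_const) auto
    moreover have "ln (det_on (E i) (V' i)) = ln (det_on (E i) (V i)) + (\<Sum>l<dim (E i). ln (\<mu> i l))" for i
      using ln_det_on_frame_op[OF subspace_E ef Vf V'f \<mu>] .
    moreover have "ln (det_on (F j) (U' j)) = ln (det_on (F j) (U j)) + (\<Sum>l<dim (F j). ln (\<nu> j l))" for j
      using ln_det_on_frame_op[OF subspace_F gh Uh U'h \<nu>] .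
    ultimately show ?thesis
      by (simp add: gaussian_value_def distrib_left sum.distrib sumI sumJ)
  qed
  then show ?thesis
    using feasible by (auto simp: gaussian_extremizer_iff U_def[abs_def] Q_def[abs_def])
qed

subsection \<open>Extremizers are stationary\<close>

text \<open>Maximality tested on competitors diagonal in a fixed frame, where both changes of log
  det are sums of logarithms of weights. Constant weights give scaling, weights 1 + t
  \<open>\<eta>\<close> the first-order variations.\<close>

lemma extremizer_frame_variation:
  assumes ext: "gaussian_extremizer E F c d B V U"
    and ef: "\<And>i. dual_frame (E i) (e i) (f i)"
    and Vf: "\<And>i x. x \<in> E i \<Longrightarrow> V i x = frame_op (E i) (f i) (\<lambda>_. 1) x"
    and gh: "\<And>j. dual_frame (F j) (g j) (h j)"
    and Uh: "\<And>j x. x \<in> F j \<Longrightarrow> U j x = frame_op (F j) (h j) (\<lambda>_. 1) x"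
    and w: "\<And>i l. l < dim (E i) \<Longrightarrow> 0 < w i l" and w': "\<And>j l. l < dim (F j) \<Longrightarrow> 0 < w' j l"
    and le: "\<And>x. x \<in> E0 \<Longrightarrow> (\<Sum>j\<in>UNIV. d j * inner (frame_op (F j) (h j) (w' j) (L j x)) (L j x))
      \<le> (\<Sum>i\<in>UNIV. c i * inner (frame_op (E i) (f i) (w i) (orth_proj (E i) x)) (orth_proj (E i) x))"
  shows "(\<Sum>j\<in>UNIV. d j * (\<Sum>l<dim (F j). ln (w' j l))) \<le> (\<Sum>i\<in>UNIV. c i * (\<Sum>l<dim (E i). ln (w i l)))"
proof -
  define V' where "V' i = frame_op (E i) (f i) (w i)" for i
  define U' where "U' j = frame_op (F j) (h j) (w' j)" for j
  have "(V', U') \<in> gaussian_feasible E F c d B"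
    unfolding gaussian_feasible_iff V'_def U'_def
    using le by (auto intro!: posdef_frame_op[OF subspace_E ef] posdef_frame_op[OF subspace_F gh] w w')
  then have "gaussian_value E F c d V' U' \<le> gaussian_value E F c d V U"
    using ext by (auto simp: gaussian_extremizer_iff)
  moreover have "ln (det_on (E i) (V' i)) = ln (det_on (E i) (V i)) + (\<Sum>l<dim (E i). ln (w i l))" for i
    by (rule ln_det_on_frame_op[OF subspace_E ef Vf _ w]) (simp_all add: V'_def)
  moreover have "ln (det_on (F j) (U' j)) = ln (det_on (F j) (U j)) + (\<Sum>l<dim (F j). ln (w' j l))" for j
    by (rule ln_det_on_frame_op[OF subspace_F gh Uh _ w']) (simp_all add: U'_def)
  ultimately show ?thesis
    by (simp add: gaussian_value_def distrib_left sum.distrib)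
qed

lemma extremizer_feasible:
  assumes "gaussian_extremizer E F c d B V U"
  shows "V i \<in> posdef_ops (E i)" and "U j \<in> posdef_ops (F j)"
    and "x \<in> E0 \<Longrightarrow> (\<Sum>j\<in>UNIV. d j * inner (U j (L j x)) (L j x))
      \<le> (\<Sum>i\<in>UNIV. c i * inner (V i (orth_proj (E i) x)) (orth_proj (E i) x))"
  using assms by (auto simp: gaussian_extremizer_def gaussian_feasible_iff)

lemma extremizer_imp_dim_eq:
  assumes ext: "gaussian_extremizer E F c d B V U"
  shows "(\<Sum>i\<in>UNIV. c i * real (dim (E i))) = (\<Sum>j\<in>UNIV. d j * real (dim (F j)))"
proof -
  note V = extremizer_feasible(1)[OF ext] and U = extremizer_feasible(2)[OF ext]
  obtain e f \<eta> where ef: "\<And>i. dual_frame (E i) (e i) (f i)"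
    and Vf: "\<And>i x. x \<in> E i \<Longrightarrow> V i x = frame_op (E i) (f i) (\<lambda>_. 1) x"
    and "\<And>i x. x \<in> E i \<Longrightarrow> V i x = frame_op (E i) (f i) (\<eta> i) x"
    by (rule diagonalize_family[OF V posdef_imp_selfadjoint[OF V] subspace_E]) (rule that)
  obtain g h \<kappa> where gh: "\<And>j. dual_frame (F j) (g j) (h j)"
    and Uh: "\<And>j x. x \<in> F j \<Longrightarrow> U j x = frame_op (F j) (h j) (\<lambda>_. 1) x"
    and "\<And>j x. x \<in> F j \<Longrightarrow> U j x = frame_op (F j) (h j) (\<kappa> j) x"
    by (rule diagonalize_family[OF U posdef_imp_selfadjoint[OF U] subspace_F]) (rule that)
  have "(\<Sum>j\<in>UNIV. d j * (\<Sum>l<dim (F j). ln s)) \<le> (\<Sum>i\<in>UNIV. c i * (\<Sum>l<dim (E i). ln s))"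
    if s: "0 < s" for s
  proof (rule extremizer_frame_variation[OF ext ef Vf gh Uh])
    fix x assume x: "x \<in> E0"
    have "s * (\<Sum>j\<in>UNIV. d j * inner (U j (L j x)) (L j x))
        \<le> s * (\<Sum>i\<in>UNIV. c i * inner (V i (orth_proj (E i) x)) (orth_proj (E i) x))"
      using extremizer_feasible(3)[OF ext x] s by simp
    then show "(\<Sum>j\<in>UNIV. d j * inner (frame_op (F j) (h j) (\<lambda>_. s) (L j x)) (L j x))
        \<le> (\<Sum>i\<in>UNIV. c i * inner (frame_op (E i) (f i) (\<lambda>_. s) (orth_proj (E i) x)) (orth_proj (E i) x))"
      unfolding frame_op_const[of _ _ s]
      by (simp add: Uh[OF L_in, symmetric] Vf[OF orth_proj_in[OF subspace_E], symmetric]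
          sum_distrib_left mult.left_commute)
  qed (use s in auto)
  \<comment> \<open>These two scalings have ln s equal to 1 and -1, which gives both inequalities
    between the weighted dimensions.\<close>
  from this[of "exp 1"] this[of "exp (-1)"] show ?thesis
    by (simp add: sum_negf)
qed

text \<open>The hypothesis says that the direction (H, K) satisfies the constraint homogeneously;
  the conclusion says that the derivative of the objective at (V, U) in this direction is not
  positive.\<close>

lemma extremizer_first_order:
  assumes ext: "gaussian_extremizer E F c d B V U"
    and v: "\<And>i r. r \<in> A i \<Longrightarrow> v i r \<in> E i" and u: "\<And>j r. r \<in> C j \<Longrightarrow> u j r \<in> F j"
    and le: "\<And>x. x \<in> E0 \<Longrightarrow> (\<Sum>j\<in>UNIV. d j * (\<Sum>r\<in>C j. \<gamma> j r * (inner (u j r) (L j x))\<^sup>2))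
      \<le> (\<Sum>i\<in>UNIV. c i * (\<Sum>r\<in>A i. \<sigma> i r * (inner (v i r) x)\<^sup>2))"
  shows "(\<Sum>j\<in>UNIV. d j * (\<Sum>r\<in>C j. \<gamma> j r * inner (inv_into (F j) (U j) (u j r)) (u j r)))
    \<le> (\<Sum>i\<in>UNIV. c i * (\<Sum>r\<in>A i. \<sigma> i r * inner (inv_into (E i) (V i) (v i r)) (v i r)))"
proof -
  note V = extremizer_feasible(1)[OF ext] and U = extremizer_feasible(2)[OF ext]
  have H: "rank_one_sum (A i) (\<sigma> i) (v i) \<in> selfadjoint_ops (E i)" for i
    using v by (intro selfadjoint_rank_one_sum[OF subspace_E])
  have K: "rank_one_sum (C j) (\<gamma> j) (u j) \<in> selfadjoint_ops (F j)" for j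
    using u by (intro selfadjoint_rank_one_sum[OF subspace_F])
  obtain e f \<eta> where ef: "\<And>i. dual_frame (E i) (e i) (f i)"
    and Vf: "\<And>i x. x \<in> E i \<Longrightarrow> V i x = frame_op (E i) (f i) (\<lambda>_. 1) x"
    and Hf: "\<And>i x. x \<in> E i \<Longrightarrow> rank_one_sum (A i) (\<sigma> i) (v i) x = frame_op (E i) (f i) (\<eta> i) x"
    by (rule diagonalize_family[OF V H subspace_E]) (rule that)
  obtain g h \<kappa> where gh: "\<And>j. dual_frame (F j) (g j) (h j)"
    and Uh: "\<And>j x. x \<in> F j \<Longrightarrow> U j x = frame_op (F j) (h j) (\<lambda>_. 1) x"
    and Kh: "\<And>j x. x \<in> F j \<Longrightarrow> rank_one_sum (C j) (\<gamma> j) (u j) x = frame_op (F j) (h j) (\<kappa> j) x"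
    by (rule diagonalize_family[OF U K subspace_F]) (rule that)
  have le': "(\<Sum>j\<in>UNIV. d j * inner (frame_op (F j) (h j) (\<kappa> j) (L j x)) (L j x))
      \<le> (\<Sum>i\<in>UNIV. c i * inner (frame_op (E i) (f i) (\<eta> i) (orth_proj (E i) x)) (orth_proj (E i) x))"
    if "x \<in> E0" for x
  proof -
    have "inner (frame_op (E i) (f i) (\<eta> i) (orth_proj (E i) x)) (orth_proj (E i) x)
        = (\<Sum>r\<in>A i. \<sigma> i r * (inner (v i r) x)\<^sup>2)" for i
      unfolding Hf[OF orth_proj_in[OF subspace_E], symmetric] inner_rank_one_sum
      using v by (intro sum.cong)
        (auto simp: inner_commute[of "v _ _"] inner_orth_proj[OF subspace_E] power2_eq_square)
    moreover have "inner (frame_op (F j) (h j) (\<kappa> j) (L j x)) (L j x)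
        = (\<Sum>r\<in>C j. \<gamma> j r * (inner (u j r) (L j x))\<^sup>2)" for j
      by (simp add: Kh[OF L_in, symmetric] inner_rank_one_sum power2_eq_square mult.assoc)
    ultimately show ?thesis using le[OF that] by simp
  qed
  have "\<forall>\<^sub>F t in at_right (0::real). (\<forall>i. \<forall>l\<in>{..<dim (E i)}. 0 < 1 + t * \<eta> i l) \<and>
      (\<forall>j. \<forall>l\<in>{..<dim (F j)}. 0 < 1 + t * \<kappa> j l)"
  proof -
    have "\<forall>\<^sub>F t in at_right (0::real). 0 < 1 + t * a" for a :: real
    proof (rule order_tendstoD)
      show "((\<lambda>t. 1 + t * a) \<longlongrightarrow> 1 + 0 * a) (at_right 0)" by (intro tendsto_intros)
    qed simp
    then show ?thesis by (simp add: eventually_conj_iff eventually_all_finite eventually_ball_finite)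
  qed
  moreover have "\<forall>\<^sub>F t in at_right (0::real). 0 < t" by (rule eventually_at_right_less)
  ultimately have "\<forall>\<^sub>F t in at_right 0.
      (\<Sum>j\<in>UNIV. d j * (\<Sum>l<dim (F j). ln (1 + t * \<kappa> j l) / t))
      \<le> (\<Sum>i\<in>UNIV. c i * (\<Sum>l<dim (E i). ln (1 + t * \<eta> i l) / t))"
  proof eventually_elim
    case (elim t)
    have "(\<Sum>j\<in>UNIV. d j * (\<Sum>l<dim (F j). ln (1 + t * \<kappa> j l)))
        \<le> (\<Sum>i\<in>UNIV. c i * (\<Sum>l<dim (E i). ln (1 + t * \<eta> i l)))"
    \<comment> \<open>The competitor is (V + t H, U + t K): smallness of t makes its weights
      positive, and its constraint is that of (V, U) plus t times \<open>le'\<close>.\<close>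
    proof (rule extremizer_frame_variation[OF ext ef Vf gh Uh])
      fix x assume x: "x \<in> E0"
      show "(\<Sum>j\<in>UNIV. d j * inner (frame_op (F j) (h j) (\<lambda>l. 1 + t * \<kappa> j l) (L j x)) (L j x))
        \<le> (\<Sum>i\<in>UNIV. c i * inner (frame_op (E i) (f i) (\<lambda>l. 1 + t * \<eta> i l) (orth_proj (E i) x)) (orth_proj (E i) x))"
        using extremizer_feasible(3)[OF ext x] mult_left_mono[OF le'[OF x], of t] elim
        by (simp add: frame_op_affine Uh[OF L_in, symmetric] Vf[OF orth_proj_in[OF subspace_E], symmetric]
            inner_add_left distrib_left sum.distrib sum_distrib_left mult.left_commute)
    qed (use elim in auto)
    then show ?case using elim
      by (simp add: sum_divide_distrib[symmetric] divide_right_mono)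
  qed
  then have "(\<Sum>j\<in>UNIV. d j * (\<Sum>l<dim (F j). \<kappa> j l)) \<le> (\<Sum>i\<in>UNIV. c i * (\<Sum>l<dim (E i). \<eta> i l))"
    by (rule tendsto_le[rotated -1])
      (auto intro!: tendsto_sum tendsto_mult ln_difference_quotient_tendsto)
  then show ?thesis
    using sum_coefficients_rank_one_sum[OF subspace_E v ef Vf Hf]
      sum_coefficients_rank_one_sum[OF subspace_F u gh Uh Kh] by simp
qed

text \<open>The moment problem lives on the whole ambient space. The vectors b -
  \<open>orth_proj E0 b\<close> control the component of z orthogonal to E0 and so make the
  coercivity hypothesis true there as well.\<close>

lemma norm_E0_decomposition:
  "inner z z = (\<Sum>i\<in>UNIV. inner (orth_proj (E i) z) (orth_proj (E i) z))
    + (\<Sum>b\<in>Basis. (inner (b - orth_proj E0 b) z)\<^sup>2)"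
proof -
  let ?w = "z - orth_proj E0 z"
  have "orth_proj E0 z = (\<Sum>i\<in>UNIV. orth_proj (E i) z)"
    using E0_decomposition[OF orth_proj_in[OF subspace_E0], of z] by (simp add: orth_proj_E_E0)
  moreover have "inner (orth_proj (E i) z) z = inner (orth_proj (E i) z) (orth_proj (E i) z)" for i
    by (metis inner_orth_proj orth_proj_in subspace_E inner_commute)
  ultimately have "inner (orth_proj E0 z) z = (\<Sum>i\<in>UNIV. inner (orth_proj (E i) z) (orth_proj (E i) z))"
    by (simp add: inner_sum_left)
  moreover have "inner ?w z = inner ?w ?w"
    using orth_proj_orth[OF subspace_E0 orth_proj_in[OF subspace_E0], of z z] by (simp add: inner_diff_right)
  moreover have "inner ?w ?w = (\<Sum>b\<in>Basis. (inner (b - orth_proj E0 b) z)\<^sup>2)"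
  proof -
    have "inner ?w b = inner (b - orth_proj E0 b) z" for b
      by (simp add: inner_diff_left orth_proj_selfadjoint[OF subspace_E0])
        (metis inner_commute orth_proj_selfadjoint[OF subspace_E0])
    then show ?thesis by (subst euclidean_inner) (simp only: power2_eq_square)
  qed
  ultimately show ?thesis by (simp add: inner_diff_left)
qed

text \<open>P is a solution of a moment problem prescribing its form as V_i^{-1} on E_i and, pulled
  back by \<open>L_adj j\<close>, as U_j^{-1} on F_j. The dual condition for solvability is exactly
  the first-order inequality.\<close>

lemma extremizer_imp_coupling:
  assumes ext: "gaussian_extremizer E F c d B V U"
  obtains P where "P \<in> couplings E (\<lambda>i. inv_into (E i) (V i))"
    and "\<And>j y. y \<in> F j \<Longrightarrow> B_cov E c B P j y = inv_into (F j) (U j) y"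
proof -
  note V = extremizer_feasible(1)[OF ext] and U = extremizer_feasible(2)[OF ext]
  obtain bE where bE: "\<And>i. dual_frame (E i) (bE i) (bE i)"
    using orthonormal_frame_exists[OF subspace_E] by metis
  obtain bF where bF: "\<And>j. dual_frame (F j) (bF j) (bF j)"
    using orthonormal_frame_exists[OF subspace_F] by metis
  define A where "A i = {..<dim (E i)} \<times> {..<dim (E i)}" for i
  define C where "C j = {..<dim (F j)} \<times> {..<dim (F j)}" for j
  define v where "v i q = bE i (fst q) + bE i (snd q)" for i q
  define u where "u j q = bF j (fst q) + bF j (snd q)" for j q
  have vE: "v i q \<in> E i" if "q \<in> A i" for i q
    using that bE[of i] by (auto simp: v_def A_def dual_frame_def intro!: subspace_add[OF subspace_E])
  have uF: "u j q \<in> F j" if "q \<in> C j" for j q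
    using that bF[of j] by (auto simp: u_def C_def dual_frame_def intro!: subspace_add[OF subspace_F])
  \<comment> \<open>Three kinds of prescribed values: on each E_i, on each F_j through
    \<open>L_adj\<close>, and zero on vectors that span the orthogonal complement of E0.\<close>
  define R where "R = (SIGMA i:UNIV. A i) <+> ((SIGMA j:UNIV. C j) <+> (Basis :: 'a set))"
  define x where "x = case_sum (\<lambda>(i, q). v i q) (case_sum (\<lambda>(j, q). L_adj j (u j q)) (\<lambda>b. b - orth_proj E0 b))"
  define \<tau> where "\<tau> = case_sum (\<lambda>(i, q). inner (inv_into (E i) (V i) (v i q)) (v i q))
    (case_sum (\<lambda>(j, q). inner (inv_into (F j) (U j) (u j q)) (u j q)) (\<lambda>_::'a. 0::real))"
  have fin: "finite (A i)" "finite (C j)" for i j by (auto simp: A_def C_def)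
  have finR: "finite R" by (auto simp: R_def fin)
  have sumR: "sum \<phi> R = (\<Sum>i\<in>UNIV. \<Sum>q\<in>A i. \<phi> (Inl (i, q))) + (\<Sum>j\<in>UNIV. \<Sum>q\<in>C j. \<phi> (Inr (Inl (j, q))))
      + (\<Sum>b\<in>Basis. \<phi> (Inr (Inr b)))" for \<phi> :: "_ \<Rightarrow> real"
    by (simp add: R_def sum.Plus sum.Sigma fin case_prod_unfold o_def)
  obtain P where P: "P \<in> possemidef_ops UNIV" "linear P"
    and Px: "\<And>r. r \<in> R \<Longrightarrow> inner (P (x r)) (x r) = \<tau> r"
  proof (rule psd_moment_problem[OF finR, of x x \<tau> "\<lambda>_. 1"])
    fix \<rho>
    assume nonneg: "\<And>z. 0 \<le> (\<Sum>r\<in>R. \<rho> r * inner (x r) z * inner (x r) z)"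
    \<comment> \<open>The coefficients \<open>\<rho>\<close> are read as a direction: those on E_i
      form H_i, those on F_j form K_j with reversed sign. Dividing by c and d undoes the weights in
      the constraint. The third kind contributes nothing, as its vectors are orthogonal to E0 and
      its targets are zero.\<close>
    have "(\<Sum>j\<in>UNIV. d j * (\<Sum>q\<in>C j. - \<rho> (Inr (Inl (j, q))) / d j * inner (inv_into (F j) (U j) (u j q)) (u j q)))
      \<le> (\<Sum>i\<in>UNIV. c i * (\<Sum>q\<in>A i. \<rho> (Inl (i, q)) / c i * inner (inv_into (E i) (V i) (v i q)) (v i q)))"
    proof (rule extremizer_first_order[OF ext vE uF])
      fix z assume z: "z \<in> E0"
      have "inner (b - orth_proj E0 b) z = 0" for b by (rule orth_proj_orth[OF subspace_E0 z])
      moreover have "inner (L_adj j y) z = inner y (L j z)" for j y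
        by (metis inner_L inner_commute)
      ultimately show "(\<Sum>j\<in>UNIV. d j * (\<Sum>q\<in>C j. - \<rho> (Inr (Inl (j, q))) / d j * (inner (u j q) (L j z))\<^sup>2))
        \<le> (\<Sum>i\<in>UNIV. c i * (\<Sum>q\<in>A i. \<rho> (Inl (i, q)) / c i * (inner (v i q) z)\<^sup>2))"
        using nonneg[of z] c_pos d_pos
        by (simp add: sumR x_def sum_distrib_left less_imp_neq[symmetric] sum_negf power2_eq_square mult.assoc)
    qed
    then show "0 \<le> (\<Sum>r\<in>R. \<rho> r * \<tau> r)"
      using c_pos d_pos
      by (simp add: sumR \<tau>_def sum_distrib_left less_imp_neq[symmetric] sum_negf)
  next
    fix z
    \<comment> \<open>Coercivity holds with all coefficients 1: the pairs (l, l) give twice the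
      basis vectors, whose squares already dominate the norm on E_i.\<close>
    have "inner (orth_proj (E i) z) (orth_proj (E i) z) \<le> (\<Sum>q\<in>A i. (inner (v i q) z)\<^sup>2)" for i
    proof -
      have "inner (orth_proj (E i) z) (orth_proj (E i) z) = (\<Sum>l<dim (E i). (inner (bE i l) z)\<^sup>2)"
        by (rule dual_frame_norm[OF subspace_E bE])
      also have "\<dots> \<le> (\<Sum>l<dim (E i). (inner (v i (l, l)) z)\<^sup>2)"
        by (intro sum_mono) (simp add: v_def inner_add_left power2_eq_square)
      also have "\<dots> = (\<Sum>q\<in>(\<lambda>l. (l, l)) ` {..<dim (E i)}. (inner (v i q) z)\<^sup>2)"
        by (simp add: sum.reindex inj_on_def)
      also have "\<dots> \<le> (\<Sum>q\<in>A i. (inner (v i q) z)\<^sup>2)"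
        by (intro sum_mono2 fin) (auto simp: A_def)
      finally show ?thesis .
    qed
    then have "inner z z \<le> (\<Sum>i\<in>UNIV. \<Sum>q\<in>A i. (inner (v i q) z)\<^sup>2)
        + (\<Sum>b\<in>Basis. (inner (b - orth_proj E0 b) z)\<^sup>2)"
      unfolding norm_E0_decomposition[of z] by (intro add_right_mono sum_mono)
    moreover have "0 \<le> (\<Sum>j\<in>UNIV. \<Sum>q\<in>C j. (inner (L_adj j (u j q)) z)\<^sup>2)"
      by (intro sum_nonneg) simp
    ultimately show "inner z z \<le> (\<Sum>r\<in>R. 1 * inner (x r) z * inner (x r) z)"
      by (simp add: sumR x_def power2_eq_square)
  qed (rule that)
  have Psym: "inner (P y) z = inner (P z) y" and Ppos: "0 \<le> inner (P y) y" for y z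
    using P(1) by (auto simp: possemidef_ops_def selfadjoint_ops_def inner_commute)
  have PE: "inner (P y) z = inner (inv_into (E i) (V i) y) z" if "y \<in> E i" "z \<in> E i" for i y z
  proof -
    have W: "inv_into (E i) (V i) \<in> selfadjoint_ops (E i)"
      by (rule posdef_imp_selfadjoint[OF posdef_inverse(2)[OF subspace_E V]])
    have "inner (P y) z = inner (inv_into (E i) (V i) (orth_proj (E i) y)) (orth_proj (E i) z)"
    proof (rule symmetric_forms_agree[OF bilinear_inner_linear[OF P(2) linear_id[unfolded id_def]]
          bilinear_selfadjoint_form[OF subspace_E W] Psym _ bE _ that])
      show "inner (inv_into (E i) (V i) (orth_proj (E i) x)) (orth_proj (E i) y) =
          inner (inv_into (E i) (V i) (orth_proj (E i) y)) (orth_proj (E i) x)" for x y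
        using W orth_proj_in[OF subspace_E] by (auto simp: selfadjoint_ops_def inner_commute)
      fix l m assume lm: "l < dim (E i)" "m < dim (E i)"
      then have "v i (l, m) \<in> E i" by (intro vE) (simp add: A_def)
      moreover have "Inl (i, (l, m)) \<in> R" using lm by (auto simp: R_def A_def C_def intro!: InlI)
      ultimately show "inner (P (bE i l + bE i m)) (bE i l + bE i m) = inner (inv_into (E i) (V i) (orth_proj (E i)
          (bE i l + bE i m))) (orth_proj (E i) (bE i l + bE i m))"
        using Px[of "Inl (i, (l, m))"] by (simp add: x_def \<tau>_def v_def orth_proj_id[OF subspace_E])
    qed
    then show ?thesis using that by (simp add: orth_proj_id[OF subspace_E])
  qed
  have PF: "inner (P (L_adj j y)) (L_adj j z) = inner (inv_into (F j) (U j) y) z" if "y \<in> F j" "z \<in> F j" for j y z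
  proof -
    have W: "inv_into (F j) (U j) \<in> selfadjoint_ops (F j)"
      by (rule posdef_imp_selfadjoint[OF posdef_inverse(2)[OF subspace_F U]])
    have "linear (\<lambda>y. P (L_adj j y))" using linear_compose[OF linear_L_adj P(2)] by (simp add: o_def)
    note bil = bilinear_inner_linear[OF this linear_L_adj[of j]]
    have "inner (P (L_adj j y)) (L_adj j z) = inner (inv_into (F j) (U j) (orth_proj (F j) y)) (orth_proj (F j) z)"
    proof (rule symmetric_forms_agree[OF bil bilinear_selfadjoint_form[OF subspace_F W] Psym _ bF _ that])
      show "inner (inv_into (F j) (U j) (orth_proj (F j) x)) (orth_proj (F j) y) =
          inner (inv_into (F j) (U j) (orth_proj (F j) y)) (orth_proj (F j) x)" for x y
        using W orth_proj_in[OF subspace_F] by (auto simp: selfadjoint_ops_def inner_commute)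
      fix l m assume lm: "l < dim (F j)" "m < dim (F j)"
      then have "u j (l, m) \<in> F j" by (intro uF) (simp add: C_def)
      moreover have "Inr (Inl (j, (l, m))) \<in> R" using lm by (auto simp: R_def A_def C_def intro!: InlI InrI)
      ultimately show "inner (P (L_adj j (bF j l + bF j m))) (L_adj j (bF j l + bF j m)) =
          inner (inv_into (F j) (U j) (orth_proj (F j) (bF j l + bF j m))) (orth_proj (F j) (bF j l + bF j m))"
        using Px[of "Inr (Inl (j, (l, m)))"] by (simp add: x_def \<tau>_def u_def orth_proj_id[OF subspace_F])
    qed
    then show ?thesis using that by (simp add: orth_proj_id[OF subspace_F])
  qed
  \<comment> \<open>A coupling must map E0 into itself. Projecting the values of P achieves this
    without changing its form on E0.\<close>
  define P' where "P' y = orth_proj E0 (P y)" for y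
  have P'in: "P' y \<in> E0" for y by (simp add: P'_def orth_proj_in[OF subspace_E0])
  have P': "inner (P' y) z = inner (P y) z" if "z \<in> E0" for y z
    using that by (simp add: P'_def inner_orth_proj[OF subspace_E0])
  show thesis
  proof
    have lin: "linear P'"
      using linear_compose[OF P(2) linear_orth_proj[OF subspace_E0]] by (simp add: P'_def[abs_def] o_def)
    have "inner (P' y) z = inner y (P' z)" if "y \<in> E0" "z \<in> E0" for y z
      using P'[OF that(2)] P'[OF that(1)] Psym[of y z] by (simp add: inner_commute[of y])
    moreover have "0 \<le> inner (P' y) y" if "y \<in> E0" for y
      using P'[OF that] Ppos by simp
    ultimately have "P' \<in> possemidef_ops E0"
      unfolding possemidef_ops_def selfadjoint_ops_def linear_on_subspace_def
      using P'in linear_add[OF lin] linear_scale[OF lin] by blast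
    then show "P' \<in> couplings E (\<lambda>i. inv_into (E i) (V i))"
      using P' PE E_subset by (simp add: couplings_def)
    show "B_cov E c B P' j y = inv_into (F j) (U j) y" if y: "y \<in> F j" for j y
    proof (rule subspace_eqI[OF subspace_F])
      show "B_cov E c B P' j y \<in> F j" by (simp add: B_cov_eq L_in)
      show "inv_into (F j) (U j) y \<in> F j"
        by (rule selfadjoint_ops_in[OF posdef_imp_selfadjoint[OF posdef_inverse(2)[OF subspace_F U]] y])
      show "inner (B_cov E c B P' j y) z = inner (inv_into (F j) (U j) y) z" if "z \<in> F j" for z
        using PF[OF y that] by (simp add: B_cov_eq inner_L P'[OF L_adj_in])
    qed
  qed
qed

text \<open>Since \<open>B_cov\<close> inverts U_j on F_j, its own inverse there is U_j, and the
  required inequality is the feasibility of (V, U).\<close>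

lemma extremizer_imp_stationary:
  assumes ext: "gaussian_extremizer E F c d B V U"
  shows "\<exists>P. P \<in> couplings E (\<lambda>i. inv_into (E i) (V i)) \<and>
    (\<forall>j. bij_betw (B_cov E c B P j) (F j) (F j)) \<and>
    loewner_le E0 (U_form E c d B (\<lambda>j. inv_into (F j) (B_cov E c B P j))) (weighted_sum_op E c V)"
proof -
  note U = extremizer_feasible(2)[OF ext]
  obtain P where P: "P \<in> couplings E (\<lambda>i. inv_into (E i) (V i))"
    and BP: "\<And>j y. y \<in> F j \<Longrightarrow> B_cov E c B P j y = inv_into (F j) (U j) y"
    using extremizer_imp_coupling[OF ext] by blast
  have bij: "bij_betw (B_cov E c B P j) (F j) (F j)" for j
    by (rule inv_into_posdef_inverse(1)[OF subspace_F U BP])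
  have "U_form E c d B (\<lambda>j. inv_into (F j) (B_cov E c B P j)) = U_form E c d B U"
    using inv_into_posdef_inverse(2)[OF subspace_F U BP L_in] by (simp add: fun_eq_iff U_form_eq)
  then have "loewner_le E0 (U_form E c d B (\<lambda>j. inv_into (F j) (B_cov E c B P j))) (weighted_sum_op E c V)"
    using ext by (simp add: gaussian_extremizer_def gaussian_feasible_def)
  then show ?thesis using P bij by blast
qed

end

theorem theorem1p14:
  fixes E :: "'k::finite \<Rightarrow> 'a::euclidean_space set"
    and F :: "'m::finite \<Rightarrow> 'b::euclidean_space set"
    and B :: "'k \<Rightarrow> 'm \<Rightarrow> 'a \<Rightarrow> 'b"
    and c :: "'k \<Rightarrow> real"
    and d :: "'m \<Rightarrow> real"
  assumes "orthogonal_subspaces E"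
    and "\<And>j. subspace (F j)"
    and "\<And>i j. linear_on_subspace (E i) (F j) (B i j)"
    and "\<And>i. 0 < c i"
    and "\<And>j. 0 < d j"
  shows "(gaussian_extremizable E F c d B \<longleftrightarrow>
      (\<Sum>i\<in>UNIV. c i * real (dim (E i))) = (\<Sum>j\<in>UNIV. d j * real (dim (F j))) \<and>
      (\<exists>V P. (\<forall>i. V i \<in> posdef_ops (E i)) \<and>
         P \<in> couplings E (\<lambda>i. inv_into (E i) (V i)) \<and>
         (\<forall>j. bij_betw (B_cov E c B P j) (F j) (F j)) \<and>
         loewner_le (total_space E)
           (U_form E c d B (\<lambda>j. inv_into (F j) (B_cov E c B P j)))
           (weighted_sum_op E c V))) \<and>
    (\<forall>V P.
      (\<Sum>i\<in>UNIV. c i * real (dim (E i))) = (\<Sum>j\<in>UNIV. d j * real (dim (F j))) \<and>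
      (\<forall>i. V i \<in> posdef_ops (E i)) \<and>
      P \<in> couplings E (\<lambda>i. inv_into (E i) (V i)) \<and>
      (\<forall>j. bij_betw (B_cov E c B P j) (F j) (F j)) \<and>
      loewner_le (total_space E)
        (U_form E c d B (\<lambda>j. inv_into (F j) (B_cov E c B P j)))
        (weighted_sum_op E c V) \<longrightarrow>
      gaussian_extremizer E F c d B V (\<lambda>j. inv_into (F j) (B_cov E c B P j)))"
proof -
  interpret gaussian_datum E F B c d
    using assms by unfold_locales
  have stationary: "\<exists>V P. (\<forall>i. V i \<in> posdef_ops (E i)) \<and> P \<in> couplings E (\<lambda>i. inv_into (E i) (V i)) \<and>
      (\<forall>j. bij_betw (B_cov E c B P j) (F j) (F j)) \<and>
      loewner_le E0 (U_form E c d B (\<lambda>j. inv_into (F j) (B_cov E c B P j))) (weighted_sum_op E c V)"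
    if "gaussian_extremizer E F c d B V U" for V U
    using extremizer_imp_stationary[OF that] extremizer_feasible(1)[OF that] by blast
  show ?thesis
    unfolding gaussian_extremizable_iff
  proof (intro conjI iffI allI impI, goal_cases)
    case 1
    then show ?case using extremizer_imp_dim_eq by blast
  next
    case 2
    then show ?case by (elim exE) (rule stationary)
  next
    case 3
    then show ?case by (elim conjE exE) (intro exI, rule stationary_imp_extremizer, simp_all)
  next
    case (4 V P)
    then show ?case by (elim conjE) (rule stationary_imp_extremizer, simp_all)
  qed
qed

end
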